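(* Let $N\ge 1$. With the notation of the context ($\mathsf L$ the loop braid category, $\mathsf{Match}^N$ the category of charge-conserving matrices, $\mathbb S^{\mathbb C}_N$, $\mathbb J^{\pm}_N\subset \mathbb S^{\mathbb C}_N$, the recipe $\mathsf R^\circ:\mathbb S^{\mathbb C}_N\to \mathsf{Match}^N(2,2)\times \mathsf{Match}^N(2,2)$, the X-symmetry and the $\Sigma_N$-symmetry): (A)(I) For every $(\lambda,\underline{x})\in\mathbb S^{\mathbb C}_N$ the pair $(S,R)=\mathsf R^\circ(\lambda,\underline{x})$ gives a charge-conserving functor $\mathsf F:\mathsf L\to\mathsf{Match}^N$ (with $\mathsf F(s)=S$, $\mathsf F(\sigma)=R$). (A)(II) Every charge-conserving functor $\mathsf F:\mathsf L\to\mathsf{Match}^N$ is in the orbit, under the X-symmetry, of the functor given by $\mathsf R^\circ(\lambda,\underline{x})$ for some $(\lambda,\underline{x})\in\mathbb S^{\mathbb C}_N$. (B)(I) For every $(\lambda,\underline{x})\in\mathbb J^{\pm}_N$ the pair $\mathsf R^\circ(\lambda,\underline{x})$ gives a charge-conserving functor $\mathsf F:\mathsf L\to\mathsf{Match}^N$. (B)(II) Every charge-conserving functor $\mathsf F:\mathsf L\to\mathsf{Match}^N$ is in the orbit, under the group of symmetries generated by the $\Sigma_N$-symmetry and the X-symmetry, of the functor given by $\mathsf R^\circ(\lambda,\underline{x})$ for some $(\lambda,\underline{x})\in\mathbb J^{\pm}_N$.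
   Context: **Source category.** The loop braid category $\mathsf L$ is (identified with) the strict monoidal groupoid with object monoid $(\mathbb N_0,+)$ generated by two invertible morphisms $\sigma,s\in\mathsf L(2,2)$ subject to: $s^2=1\otimes 1$; $s_1s_2s_1=s_2s_1s_2$; (I) $\sigma_1\sigma_2\sigma_1=\sigma_2\sigma_1\sigma_2$; (II) $\sigma_1\sigma_2s_1=s_2\sigma_1\sigma_2$; (III) $\sigma_1s_2s_1=s_2s_1\sigma_2$. Here $1$ is the identity morphism of object $1$, $x_1=x\otimes 1$, $x_2=1\otimes x$. **Target category.** Let $\underline N=\{1,\dots,N\}$. $\mathsf{Match}^N$ is the monoidal category with objects $n\in\mathbb N_0$, whose only (nonzero) morphisms are endomorphisms; $\mathsf{Match}^N(n,n)$ is the set of complex matrices $M$ with rows and columns indexed by words in $\underline N^n$ that are charge conserving: $\langle w|M|w'\rangle\neq 0$ implies that $w$ is a place permutation of $w'$. Composition is the matrix product; on objects $n\otimes m=n+m$; on morphisms $\langle vv'|M\otimes M'|ww'\rangle=\langle v|M|w\rangle\langle v'|M'|w'\rangle$ (concatenated words). A charge-conserving functor is a strict monoidal functor $\mathsf F:\mathsf L\to\mathsf{Match}^N$ with $\mathsf F(1)=1$ on objects. It is determined by the pair $(\mathsf F(s),\mathsf F(\sigma))$ in $\mathsf{Match}^N(2,2)$; a pair $(S,R)$ "gives a functor" if there is such an $\mathsf F$ with $\mathsf F(s)=S$, $\mathsf F(\sigma)=R$ (i.e. $S,R$ are invertible and satisfy the images of all the relations, where $R_1=R\otimes 1_N$,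 $R_2=1_N\otimes R$, etc.). **Encoding.** $M\in\mathsf{Match}^N(2,2)$ is encoded by the scalars $\langle ii|M|ii\rangle$ for $i\in\underline N$ and, for each $i<j$, the $2\times2$ block with rows and columns indexed in the order $(ji,ij)$: $\begin{pmatrix}\langle ji|M|ji\rangle&\langle ji|M|ij\rangle\\ \langle ij|M|ji\rangle&\langle ij|M|ij\rangle\end{pmatrix}$. For $R$ write $a_i$ and $A(i,j)$; for $S$ write $b_i$ and $B(i,j)$. **Symmetries.** X-symmetry: for an invertible diagonal matrix $X\in\mathsf{Match}^N(2,2)$, $(S,R)\mapsto(XSX^{-1},XRX^{-1})$. $\Sigma_N$-symmetry: for $w$ in the symmetric group $\Sigma_N$, $(S,R)\mapsto(f^w(S),f^w(R))$ where $\langle u|f^w(M)|v\rangle=\langle wu|M|wv\rangle$, $w$ acting letterwise on words. Both send pairs giving functors to pairs giving functors. **Index set $\mathbb S_N$.** An element $\lambda\in\mathbb S_N$ consists of: a set partition of $\underline N$ into nonempty parts called nations; for each nation an ordered pair (first/top county, second/bottom county) of disjoint subsets whose union is the nation, the top county being nonempty (the bottom may be empty); and a sign $\mathrm{sgn}(n)\in\{+1,-1\}$ for each nation $n$ (equivalently a partition of the set of nations into an ordered pair of subsets, the first having sign $+$, the second $-$). The nations are totally ordered $n_1,\dots,n_m$: first all nations of sign $+$, then those of sign $-$; within a sign by increasing size; then by increasing size of the second county; ties are broken by putting the nation with the smallest resident first. **Parameters.** For $\lambda\in\mathbb S_N$, a point $\underline x$ of the parameter space $\mathbb C^\lambda$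 consists of: a nonzero complex number $\alpha_s$ for the top county of each nation $n_s$; a nonzero complex number $\beta_s$ for the second county of each nation $n_s$ with nonempty second county, with $\alpha_s+\beta_s\neq0$; and for each pair $s<t$ two nonzero complex numbers $\mu_{s,t},C_{s,t}$. For $s>t$ one sets $\mu_{s,t}=\mu_{t,s}$, $C_{s,t}=1/C_{t,s}$. $\mathbb S^{\mathbb C}_N$ is the set of pairs $(\lambda,\underline x)$ with $\lambda\in\mathbb S_N$, $\underline x\in\mathbb C^\lambda$. **Recipe.** $\mathsf R^\circ(\lambda,\underline x)=(S,R)$ is defined as follows. If $i$ is in the top county of $n_s$ then $a_i=\alpha_s$, $b_i=\mathrm{sgn}(n_s)$; if $i$ is in the second county of $n_s$ then $a_i=\beta_s$, $b_i=-\mathrm{sgn}(n_s)$. For $i<j$: 1. if $i\in n_s$, $j\in n_t$, $s\ne t$: $A(i,j)=\begin{pmatrix}0&\mu_{s,t}/C_{s,t}\\ \mu_{s,t}C_{s,t}&0\end{pmatrix}$, $B(i,j)=\begin{pmatrix}0&1\\1&0\end{pmatrix}$; 2. if $i,j$ are in the same nation $n_s$ but different counties, then $B(i,j)=\begin{pmatrix}0&1\\1&0\end{pmatrix}$, and $A(i,j)=\begin{pmatrix}\alpha_s+\beta_s&\mathrm{sgn}(n_s)\alpha_s\\-\mathrm{sgn}(n_s)\beta_s&0\end{pmatrix}$ if $i$ is in the top county, $A(i,j)=\begin{pmatrix}0&-\mathrm{sgn}(n_s)\beta_s\\ \mathrm{sgn}(n_s)\alpha_s&\alpha_s+\beta_s\end{pmatrix}$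 if $j$ is in the top county; 3. if $i,j$ are both in the top county of $n_s$: $A(i,j)=\alpha_s I_2$, $B(i,j)=\mathrm{sgn}(n_s)I_2$; if both are in the second county of $n_s$: $A(i,j)=\beta_s I_2$, $B(i,j)=-\mathrm{sgn}(n_s)I_2$. **The subset $\mathbb J^\pm_N$.** Let $J_N^\pm$ be the set of ordered pairs of finite multisets of elements $(p,q)\in\mathbb N_{\geq1}\times\mathbb N_0$ (compositions with at most two parts) such that the sum of $p+q$ over all elements of both multisets, with multiplicity, is $N$. Each element of $J_N^\pm$ determines an element of $\mathbb S_N$: list the compositions with those of the first multiset (sign $+$) first and those of the second (sign $-$) after, within each sign by increasing $p+q$, then by increasing $q$; then fill in $1,2,\dots,N$ in order, going through the compositions in this order and, within $(p,q)$, filling first the top county (of size $p$) and then the second county (of size $q$). This gives an injection $J^\pm_N\hookrightarrow\mathbb S_N$. $\mathbb J^\pm_N$ is the set of $(\lambda,\underline x)\in\mathbb S^{\mathbb C}_N$ with $\lambda$ in the image of $J^\pm_N$. *)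

theory Defs
  imports
    Complex_Main
    "HOL-Library.Multiset"
    "HOL-Library.Disjoint_Sets"
    "HOL-Combinatorics.Permutations"
    "HOL-Algebra.Generated_Groups"
    "HOL-Algebra.Bij"
begin

section \<open>Strict monoidal categories with object monoid the natural numbers\<close>

text \<open>Composition is written in diagrammatic order: for \<open>f \<in> Hom C l m\<close> and \<open>g \<in> Hom C m n\<close>,
  \<open>Cmp C l m n f g \<in> Hom C l n\<close> stands for the juxtaposition \<open>f g\<close>; in the matrix category this is
  the matrix product in the same order.  The object arguments of the operations are the sources and
  targets of the morphisms.\<close>

record 'm moncat =
  Hom :: "nat \<Rightarrow> nat \<Rightarrow> 'm set"
  Ident :: "nat \<Rightarrow> 'm"
  Cmp :: "nat \<Rightarrow> nat \<Rightarrow> nat \<Rightarrow> 'm \<Rightarrow> 'm \<Rightarrow> 'm"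
  Tens :: "nat \<Rightarrow> nat \<Rightarrow> nat \<Rightarrow> nat \<Rightarrow> 'm \<Rightarrow> 'm \<Rightarrow> 'm"

definition strict_monoidal_functor ::
  "'a moncat \<Rightarrow> 'b moncat \<Rightarrow> (nat \<Rightarrow> nat) \<Rightarrow> (nat \<Rightarrow> nat \<Rightarrow> 'a \<Rightarrow> 'b) \<Rightarrow> bool" where
  "strict_monoidal_functor C D FO F \<longleftrightarrow>
     FO 0 = 0 \<and> (\<forall>m n. FO (m + n) = FO m + FO n) \<and>
     (\<forall>m n. \<forall>f \<in> Hom C m n. F m n f \<in> Hom D (FO m) (FO n)) \<and>
     (\<forall>n. F n n (Ident C n) = Ident D (FO n)) \<and>
     (\<forall>l m n. \<forall>f \<in> Hom C l m. \<forall>g \<in> Hom C m n.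
        F l n (Cmp C l m n f g) = Cmp D (FO l) (FO m) (FO n) (F l m f) (F m n g)) \<and>
     (\<forall>k l m n. \<forall>f \<in> Hom C k l. \<forall>g \<in> Hom C m n.
        F (k + m) (l + n) (Tens C k l m n f g)
          = Tens D (FO k) (FO l) (FO m) (FO n) (F k l f) (F m n g))"


section \<open>The loop braid category\<close>

text \<open>The presented category: well-formed formal expressions in the generators, their formal
  inverses and identities, modulo the congruence generated by the axioms of a strict monoidal
  category, the invertibility of the generators, and the defining relations.  Every morphism is an
  endomorphism; \<open>arity t\<close> is the object on which \<open>t\<close> lives.\<close>

datatype lgen = Sigma | Swap

datatype lterm = LId nat | LGen lgen | LInv lgen | LCmp lterm lterm | LTens lterm lterm

primrec arity :: "lterm \<Rightarrow> nat" where
  "arity (LId n) = n"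
| "arity (LGen g) = 2"
| "arity (LInv g) = 2"
| "arity (LCmp t u) = arity t"
| "arity (LTens t u) = arity t + arity u"

primrec wf_lterm :: "lterm \<Rightarrow> bool" where
  "wf_lterm (LId n) \<longleftrightarrow> True"
| "wf_lterm (LGen g) \<longleftrightarrow> True"
| "wf_lterm (LInv g) \<longleftrightarrow> True"
| "wf_lterm (LCmp t u) \<longleftrightarrow> wf_lterm t \<and> wf_lterm u \<and> arity t = arity u"
| "wf_lterm (LTens t u) \<longleftrightarrow> wf_lterm t \<and> wf_lterm u"

definition at1 :: "lgen \<Rightarrow> lterm" where
  "at1 g = LTens (LGen g) (LId 1)"

definition at2 :: "lgen \<Rightarrow> lterm" where
  "at2 g = LTens (LId 1) (LGen g)"

definition cmp3 :: "lterm \<Rightarrow> lterm \<Rightarrow> lterm \<Rightarrow> lterm" where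
  "cmp3 t u v = LCmp (LCmp t u) v"

inductive lrel :: "lterm \<Rightarrow> lterm \<Rightarrow> bool" where
  lrel_refl: "wf_lterm t \<Longrightarrow> lrel t t"
| lrel_sym: "lrel t u \<Longrightarrow> lrel u t"
| lrel_trans: "lrel t u \<Longrightarrow> lrel u v \<Longrightarrow> lrel t v"
| lrel_cmp: "lrel t t' \<Longrightarrow> lrel u u' \<Longrightarrow> arity t = arity u \<Longrightarrow> lrel (LCmp t u) (LCmp t' u')"
| lrel_tens: "lrel t t' \<Longrightarrow> lrel u u' \<Longrightarrow> lrel (LTens t u) (LTens t' u')"
| id_left: "wf_lterm t \<Longrightarrow> lrel (LCmp (LId (arity t)) t) t"
| id_right: "wf_lterm t \<Longrightarrow> lrel (LCmp t (LId (arity t))) t"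
| cmp_assoc: "wf_lterm (LCmp (LCmp t u) v) \<Longrightarrow> lrel (LCmp (LCmp t u) v) (LCmp t (LCmp u v))"
| tens_unit_left: "wf_lterm t \<Longrightarrow> lrel (LTens (LId 0) t) t"
| tens_unit_right: "wf_lterm t \<Longrightarrow> lrel (LTens t (LId 0)) t"
| tens_assoc: "wf_lterm (LTens (LTens t u) v) \<Longrightarrow>
    lrel (LTens (LTens t u) v) (LTens t (LTens u v))"
| tens_id: "lrel (LTens (LId m) (LId n)) (LId (m + n))"
| interchange: "wf_lterm (LCmp t u) \<Longrightarrow> wf_lterm (LCmp t' u') \<Longrightarrow>
    lrel (LCmp (LTens t t') (LTens u u')) (LTens (LCmp t u) (LCmp t' u'))"
| inv_right: "lrel (LCmp (LGen g) (LInv g)) (LId 2)"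
| inv_left: "lrel (LCmp (LInv g) (LGen g)) (LId 2)"
| swap_invol: "lrel (LCmp (LGen Swap) (LGen Swap)) (LTens (LId 1) (LId 1))"
| swap_braid: "lrel (cmp3 (at1 Swap) (at2 Swap) (at1 Swap)) (cmp3 (at2 Swap) (at1 Swap) (at2 Swap))"
| rel_I: "lrel (cmp3 (at1 Sigma) (at2 Sigma) (at1 Sigma))
               (cmp3 (at2 Sigma) (at1 Sigma) (at2 Sigma))"
| rel_II: "lrel (cmp3 (at1 Sigma) (at2 Sigma) (at1 Swap))
                (cmp3 (at2 Swap) (at1 Sigma) (at2 Sigma))"
| rel_III: "lrel (cmp3 (at1 Sigma) (at2 Swap) (at1 Swap))
                 (cmp3 (at2 Swap) (at1 Swap) (at2 Sigma))"

definition lclass :: "lterm \<Rightarrow> lterm set" where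
  "lclass t = {u. lrel t u}"

definition LoopBraid :: "lterm set moncat" where
  "LoopBraid = \<lparr>
     Hom = (\<lambda>m n. if m = n then {lclass t | t. wf_lterm t \<and> arity t = n} else {}),
     Ident = (\<lambda>n. lclass (LId n)),
     Cmp = (\<lambda>_ _ _ f g. \<Union>t\<in>f. \<Union>u\<in>g. lclass (LCmp t u)),
     Tens = (\<lambda>_ _ _ _ f g. \<Union>t\<in>f. \<Union>u\<in>g. lclass (LTens t u)) \<rparr>"


section \<open>Charge-conserving matrices\<close>

type_synonym cmat = "nat list \<Rightarrow> nat list \<Rightarrow> complex"

text \<open>Words over the alphabet \<open>{1..N}\<close>.  A matrix \<open>M\<close> has entries \<open>M u v\<close> (row \<open>u\<close>, column \<open>v\<close>) and
  vanishes outside its index sets.  Equality of multisets of letters says that one word is a place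
  permutation of the other; for \<open>m \<noteq> n\<close> it leaves only the zero matrix in \<open>match_hom N m n\<close>.\<close>

definition words :: "nat \<Rightarrow> nat \<Rightarrow> nat list set" where
  "words N n = {w. set w \<subseteq> {1..N} \<and> length w = n}"

definition match_hom :: "nat \<Rightarrow> nat \<Rightarrow> nat \<Rightarrow> cmat set" where
  "match_hom N m n =
     {M. \<forall>u v. M u v \<noteq> 0 \<longrightarrow> u \<in> words N m \<and> v \<in> words N n \<and> mset u = mset v}"

definition mat_id :: "nat \<Rightarrow> nat \<Rightarrow> cmat" where
  "mat_id N n = (\<lambda>u v. if u \<in> words N n \<and> u = v then 1 else 0)"

definition mat_mul :: "nat \<Rightarrow> nat \<Rightarrow> cmat \<Rightarrow> cmat \<Rightarrow> cmat" where
  "mat_mul N m M M' = (\<lambda>u v. \<Sum>w\<in>words N m. M u w * M' w v)"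

definition mat_tens :: "nat \<Rightarrow> nat \<Rightarrow> cmat \<Rightarrow> cmat \<Rightarrow> cmat" where
  "mat_tens k l M M' = (\<lambda>u v. M (take k u) (take l v) * M' (drop k u) (drop l v))"

definition Match :: "nat \<Rightarrow> cmat moncat" where
  "Match N = \<lparr>
     Hom = match_hom N,
     Ident = mat_id N,
     Cmp = (\<lambda>_ m _. mat_mul N m),
     Tens = (\<lambda>k l _ _. mat_tens k l) \<rparr>"


section \<open>Charge-conserving functors and their symmetries\<close>

definition charge_conserving_functor ::
  "nat \<Rightarrow> (nat \<Rightarrow> nat) \<Rightarrow> (nat \<Rightarrow> nat \<Rightarrow> lterm set \<Rightarrow> cmat) \<Rightarrow> bool" where
  "charge_conserving_functor N FO F \<longleftrightarrow>
     strict_monoidal_functor LoopBraid (Match N) FO F \<and> FO 1 = 1"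

text \<open>The pair \<open>(S, R)\<close> of images of the generators \<open>s\<close> and \<open>\<sigma>\<close>, in this order.\<close>

definition gen_images :: "(nat \<Rightarrow> nat \<Rightarrow> lterm set \<Rightarrow> cmat) \<Rightarrow> cmat \<times> cmat" where
  "gen_images F = (F 2 2 (lclass (LGen Swap)), F 2 2 (lclass (LGen Sigma)))"

definition gives_functor :: "nat \<Rightarrow> cmat \<times> cmat \<Rightarrow> bool" where
  "gives_functor N P \<longleftrightarrow> (\<exists>FO F. charge_conserving_functor N FO F \<and> gen_images F = P)"

definition match_pairs :: "nat \<Rightarrow> (cmat \<times> cmat) set" where
  "match_pairs N = match_hom N 2 2 \<times> match_hom N 2 2"

definition x_map :: "nat \<Rightarrow> cmat \<Rightarrow> cmat \<Rightarrow> cmat \<times> cmat \<Rightarrow> cmat \<times> cmat" where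
  "x_map N X Y = (\<lambda>(S, R)\<in>match_pairs N.
     (mat_mul N 2 (mat_mul N 2 X S) Y, mat_mul N 2 (mat_mul N 2 X R) Y))"

definition x_symmetries :: "nat \<Rightarrow> (cmat \<times> cmat \<Rightarrow> cmat \<times> cmat) set" where
  "x_symmetries N = {x_map N X Y | X Y.
     X \<in> match_hom N 2 2 \<and> (\<forall>u v. X u v \<noteq> 0 \<longrightarrow> u = v) \<and>
     Y \<in> match_hom N 2 2 \<and> mat_mul N 2 X Y = mat_id N 2 \<and> mat_mul N 2 Y X = mat_id N 2}"

definition relabel :: "(nat \<Rightarrow> nat) \<Rightarrow> cmat \<Rightarrow> cmat" where
  "relabel w M = (\<lambda>u v. M (map w u) (map w v))"

definition perm_symmetries :: "nat \<Rightarrow> (cmat \<times> cmat \<Rightarrow> cmat \<times> cmat) set" where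
  "perm_symmetries N =
     {\<lambda>(S, R)\<in>match_pairs N. (relabel w S, relabel w R) | w. w permutes {1..N}}"

text \<open>The subgroup generated by both kinds of symmetries inside the group of all bijections of the
  set of pairs of matrices.\<close>

definition symmetry_group :: "nat \<Rightarrow> (cmat \<times> cmat \<Rightarrow> cmat \<times> cmat) set" where
  "symmetry_group N =
     generate (BijGroup (match_pairs N)) (perm_symmetries N \<union> x_symmetries N)"


section \<open>The index set and the parameters\<close>

text \<open>A nation carries its top and bottom county and its sign (\<open>1\<close> or \<open>- 1\<close>).\<close>

datatype nation = Nation (top_county: "nat set") (bottom_county: "nat set") (sign: int)

definition residents :: "nation \<Rightarrow> nat set" where
  "residents n = top_county n \<union> bottom_county n"

text \<open>Injectivity of \<^term>\<open>residents\<close> makes every part of the set partition carry just one choice of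
  counties and sign.\<close>

definition index_set :: "nat \<Rightarrow> nation set set" where
  "index_set N = {\<Lambda>. partition_on {1..N} (residents ` \<Lambda>) \<and> inj_on residents \<Lambda> \<and>
     (\<forall>n\<in>\<Lambda>. top_county n \<inter> bottom_county n = {} \<and> top_county n \<noteq> {} \<and> sign n \<in> {1, - 1})}"

definition precedes :: "nation \<Rightarrow> nation \<Rightarrow> bool" where
  "precedes n n' \<longleftrightarrow>
     sign n > sign n' \<or> sign n = sign n' \<and>
     (card (residents n) < card (residents n') \<or> card (residents n) = card (residents n') \<and>
      (card (bottom_county n) < card (bottom_county n') \<or>
       card (bottom_county n) = card (bottom_county n') \<and>
       Min (residents n) < Min (residents n')))"

text \<open>The position \<open>s\<close> of the nation \<open>n\<^sub>s\<close> in the total order, starting from \<open>1\<close>.\<close>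

definition rank :: "nation set \<Rightarrow> nation \<Rightarrow> nat" where
  "rank \<Lambda> n = card {n' \<in> \<Lambda>. precedes n' n} + 1"

text \<open>Only the values of \<open>par_alpha\<close>, \<open>par_beta\<close> at positions of nations (with nonempty bottom county
  in the case of \<open>par_beta\<close>) and those of \<open>par_mu\<close>, \<open>par_C\<close> at pairs \<open>s < t\<close> of positions are
  relevant.\<close>

record params =
  par_alpha :: "nat \<Rightarrow> complex"
  par_beta :: "nat \<Rightarrow> complex"
  par_mu :: "nat \<Rightarrow> nat \<Rightarrow> complex"
  par_C :: "nat \<Rightarrow> nat \<Rightarrow> complex"

definition param_space :: "nation set \<Rightarrow> params set" where
  "param_space \<Lambda> = {x.
     (\<forall>n\<in>\<Lambda>. par_alpha x (rank \<Lambda> n) \<noteq> 0 \<and>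
        (bottom_county n \<noteq> {} \<longrightarrow>
           par_beta x (rank \<Lambda> n) \<noteq> 0 \<and> par_alpha x (rank \<Lambda> n) + par_beta x (rank \<Lambda> n) \<noteq> 0)) \<and>
     (\<forall>s t. 1 \<le> s \<and> s < t \<and> t \<le> card \<Lambda> \<longrightarrow> par_mu x s t \<noteq> 0 \<and> par_C x s t \<noteq> 0)}"

definition param_index_set :: "nat \<Rightarrow> (nation set \<times> params) set" where
  "param_index_set N = (SIGMA \<Lambda>:index_set N. param_space \<Lambda>)"

definition mu :: "params \<Rightarrow> nat \<Rightarrow> nat \<Rightarrow> complex" where
  "mu x s t = (if s < t then par_mu x s t else par_mu x t s)"

definition C_par :: "params \<Rightarrow> nat \<Rightarrow> nat \<Rightarrow> complex" where
  "C_par x s t = (if s < t then par_C x s t else 1 / par_C x t s)"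


section \<open>The recipe\<close>

text \<open>A \<open>2 \<times> 2\<close> block is the pair of its rows.\<close>

type_synonym block = "(complex \<times> complex) \<times> (complex \<times> complex)"

definition scalar_block :: "complex \<Rightarrow> block" where
  "scalar_block c = ((c, 0), (0, c))"

definition flip_block :: block where
  "flip_block = ((0, 1), (1, 0))"

text \<open>The element of \<open>match_hom N 2 2\<close> with diagonal scalars \<open>a i\<close> and blocks \<open>A i j\<close> for \<open>i < j\<close>,
  where rows and columns of \<open>A i j\<close> are indexed in the order \<open>[j, i], [i, j]\<close>.\<close>

definition decode :: "nat \<Rightarrow> (nat \<Rightarrow> complex) \<Rightarrow> (nat \<Rightarrow> nat \<Rightarrow> block) \<Rightarrow> cmat" where
  "decode N a A = (\<lambda>u v.
     if u \<in> words N 2 \<and> v \<in> words N 2 \<and> mset u = mset v then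
       (let k = u ! 0; l = u ! 1; ((p, q), (r, t)) = A (min k l) (max k l) in
        if k = l then a k
        else if k > l then (if v = u then p else q)
        else (if v = u then t else r))
     else 0)"

lemma decode_in_match_hom: "decode N a A \<in> match_hom N 2 2"
  by (auto simp: decode_def match_hom_def split: if_splits)

lemma decode_scalar: "i \<in> {1..N} \<Longrightarrow> decode N a A [i, i] [i, i] = a i"
  by (simp add: decode_def words_def Let_def split: prod.splits)

lemma decode_block:
  assumes "i \<in> {1..N}" "j \<in> {1..N}" "i < j"
  shows "((decode N a A [j, i] [j, i], decode N a A [j, i] [i, j]),
          (decode N a A [i, j] [j, i], decode N a A [i, j] [i, j])) = A i j"
  using assms by (auto simp: decode_def words_def Let_def min_def max_def split: prod.splits)

definition nation_of :: "nation set \<Rightarrow> nat \<Rightarrow> nation" where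
  "nation_of \<Lambda> i = (THE n. n \<in> \<Lambda> \<and> i \<in> residents n)"

definition recipe_a :: "nation set \<Rightarrow> params \<Rightarrow> nat \<Rightarrow> complex" where
  "recipe_a \<Lambda> x i = (let n = nation_of \<Lambda> i in
     if i \<in> top_county n then par_alpha x (rank \<Lambda> n) else par_beta x (rank \<Lambda> n))"

definition recipe_b :: "nation set \<Rightarrow> nat \<Rightarrow> complex" where
  "recipe_b \<Lambda> i = (let n = nation_of \<Lambda> i in
     if i \<in> top_county n then of_int (sign n) else - of_int (sign n))"

definition recipe_A :: "nation set \<Rightarrow> params \<Rightarrow> nat \<Rightarrow> nat \<Rightarrow> block" where
  "recipe_A \<Lambda> x i j =
     (let n = nation_of \<Lambda> i; n' = nation_of \<Lambda> j; s = rank \<Lambda> n; t = rank \<Lambda> n';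
          \<alpha> = par_alpha x s; \<beta> = par_beta x s; \<epsilon> = of_int (sign n) in
      if n \<noteq> n' then ((0, mu x s t / C_par x s t), (mu x s t * C_par x s t, 0))
      else if i \<in> top_county n \<and> j \<in> bottom_county n then ((\<alpha> + \<beta>, \<epsilon> * \<alpha>), (- \<epsilon> * \<beta>, 0))
      else if i \<in> bottom_county n \<and> j \<in> top_county n then ((0, - \<epsilon> * \<beta>), (\<epsilon> * \<alpha>, \<alpha> + \<beta>))
      else if i \<in> top_county n then scalar_block \<alpha>
      else scalar_block \<beta>)"

definition recipe_B :: "nation set \<Rightarrow> nat \<Rightarrow> nat \<Rightarrow> block" where
  "recipe_B \<Lambda> i j =
     (let n = nation_of \<Lambda> i; n' = nation_of \<Lambda> j; \<epsilon> = of_int (sign n) in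
      if n \<noteq> n' then flip_block
      else if i \<in> top_county n \<and> j \<in> top_county n then scalar_block \<epsilon>
      else if i \<in> bottom_county n \<and> j \<in> bottom_county n then scalar_block (- \<epsilon>)
      else flip_block)"

definition recipe :: "nat \<Rightarrow> nation set \<times> params \<Rightarrow> cmat \<times> cmat" where
  "recipe N = (\<lambda>(\<Lambda>, x). (decode N (recipe_b \<Lambda>) (recipe_B \<Lambda>),
                          decode N (recipe_a \<Lambda> x) (recipe_A \<Lambda> x)))"


section \<open>Representatives up to relabelling\<close>

definition signed_multicompositions :: "nat \<Rightarrow> ((nat \<times> nat) multiset \<times> (nat \<times> nat) multiset) set"
where
  "signed_multicompositions N = {(P, Q). (\<forall>(p, q) \<in># P + Q. p \<ge> 1) \<and> (\<Sum>(p, q) \<in># P + Q. p + q) = N}"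

definition comp_le :: "nat \<times> nat \<Rightarrow> nat \<times> nat \<Rightarrow> bool" where
  "comp_le = (\<lambda>(p, q) (p', q'). p + q < p' + q' \<or> p + q = p' + q' \<and> q \<le> q')"

definition ordered_list :: "(nat \<times> nat) multiset \<Rightarrow> (nat \<times> nat) list" where
  "ordered_list P = (THE xs. mset xs = P \<and> sorted_wrt comp_le xs)"

fun fill :: "nat \<Rightarrow> (int \<times> nat \<times> nat) list \<Rightarrow> nation set" where
  "fill k [] = {}"
| "fill k ((\<epsilon>, p, q) # cs) =
     insert (Nation {k..<k + p} {k + p..<k + p + q} \<epsilon>) (fill (k + p + q) cs)"

definition standard_index :: "(nat \<times> nat) multiset \<times> (nat \<times> nat) multiset \<Rightarrow> nation set" where
  "standard_index = (\<lambda>(P, Q).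
     fill 1 (map (Pair 1) (ordered_list P) @ map (Pair (- 1)) (ordered_list Q)))"

definition standard_param_index_set :: "nat \<Rightarrow> (nation set \<times> params) set" where
  "standard_param_index_set N =
     {(\<Lambda>, x) \<in> param_index_set N. \<Lambda> \<in> standard_index ` signed_multicompositions N}"

end

theory Submission
  imports Defs
begin

text \<open>Write \<open>dg M x y\<close> and \<open>off M x y\<close> for the entries of a charge-conserving matrix from the word
  \<open>xy\<close> to \<open>xy\<close> and to \<open>yx\<close>.  Each cubic relation, read on a word \<open>xyz\<close>, becomes six polynomial
  equations, one for each rearrangement of \<open>xyz\<close>.

  The recipe satisfies them formally, because its entries depend only on the nation and the county
  of the letters.  Conversely, the relations for \<open>S\<close> alone force every block of \<open>S\<close> to be scalar or
  antidiagonal, and a diagonal conjugation turns the antidiagonal ones into flips.  The mixed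
  relations on two letters then leave three kinds of pairs: both blocks scalar (same county), both
  antidiagonal (different nations), or \<open>S\<close> a flip and \<open>R\<close> with exactly one nonzero diagonal entry
  (top and bottom of the same nation).  The equations on three distinct letters say that being of
  the first kind, and being of the first or third kind, are equivalence relations, and that the
  off-diagonal entries between different nations depend only on the nations.

  For the last part, the nations are listed in their total order and their residents are renumbered
  consecutively; this does not change the position of a nation, so the same parameters serve.\<close>

section \<open>Charge-conserving matrices form a strict monoidal category\<close>

text \<open>A diagonal \<open>X\<close> on two letters need not come from a diagonal matrix on
  single letters, so it is not evident that conjugation by it respects relations on three letters.
  Charge conservation is what saves it: if a three-letter word is weighted by the product of the
  weights of its three pairs of letters, an exchange of neighbours reverses exactly one pair. Both
  sides of every cubic relation are then conjugated by one common diagonal matrix. Only this permits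
  normalising \<open>S\<close> before \<open>R\<close> is examined.

  After normalisation the two counties of a nation are still to be told apart. The orientation of a
  mixed block does it: its diagonal entry \<open>\<alpha> + \<beta>\<close> sits at the word that
  begins in the second county. That no letter is second in one block and first in another, and that
  no nation has three counties, is what the three-letter forms of relations I and II exclude.
  Finally, the two antidiagonal entries between two nations are traded for \<open>\<mu>\<close> and
  \<open>C\<close> by a complex square root.\<close>

lemma finite_words [simp]: "finite (words N n)"
  unfolding words_def by (rule finite_lists_length_eq) simp

lemma words_0: "words N 0 = {[]}"
  by (auto simp: words_def)

lemma words_split: "u \<in> words N (m + n) \<longleftrightarrow> take m u \<in> words N m \<and> drop m u \<in> words N n"
proof -
  have "set u = set (take m u) \<union> set (drop m u)"
    by (metis append_take_drop_id set_append)
  then show ?thesis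
    unfolding words_def by auto
qed

text \<open>Cutting at position \<open>m\<close> is a bijection from words to pairs of words; the
  interchange law rests on this factorisation of the sum over middle words.\<close>

lemma sum_words_split:
  "(\<Sum>w\<in>words N (m + n). f (take m w) (drop m w))
     = (\<Sum>p\<in>words N m. \<Sum>q\<in>words N n. f p q)"
proof -
  have "(\<Sum>w\<in>words N (m + n). f (take m w) (drop m w))
      = (\<Sum>(p, q)\<in>words N m \<times> words N n. f p q)"
    by (rule sum.reindex_bij_witness[where j = "\<lambda>w. (take m w, drop m w)" and i = "\<lambda>(p, q). p @ q"])
      (auto simp: words_split, auto simp: words_def)
  then show ?thesis
    by (simp add: sum.cartesian_product)
qed

lemma mat_id_in_hom: "mat_id N n \<in> match_hom N n n"
  by (auto simp: match_hom_def mat_id_def split: if_splits)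

lemma mat_mul_in_hom:
  assumes "M \<in> match_hom N l m" "M' \<in> match_hom N m n"
  shows "mat_mul N m M M' \<in> match_hom N l n"
  unfolding match_hom_def
proof (intro CollectI allI impI)
  fix u v
  assume "mat_mul N m M M' u v \<noteq> 0"
  then obtain w where "M u w * M' w v \<noteq> 0"
    unfolding mat_mul_def by (auto elim: sum.not_neutral_contains_not_neutral)
  then have "M u w \<noteq> 0" "M' w v \<noteq> 0"
    by auto
  with assms show "u \<in> words N l \<and> v \<in> words N n \<and> mset u = mset v"
    by (simp add: match_hom_def)
qed

lemma mat_tens_in_hom:
  assumes "M \<in> match_hom N k l" "M' \<in> match_hom N m n"
  shows "mat_tens k l M M' \<in> match_hom N (k + m) (l + n)"
  unfolding match_hom_def
proof (intro CollectI allI impI)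
  fix u v
  assume "mat_tens k l M M' u v \<noteq> 0"
  then have "M (take k u) (take l v) \<noteq> 0" "M' (drop k u) (drop l v) \<noteq> 0"
    by (auto simp: mat_tens_def)
  with assms have *: "take k u \<in> words N k" "take l v \<in> words N l" "mset (take k u) = mset (take l v)"
      "drop k u \<in> words N m" "drop l v \<in> words N n" "mset (drop k u) = mset (drop l v)"
    by (auto simp: match_hom_def)
  have "mset u = mset (take k u) + mset (drop k u)" "mset v = mset (take l v) + mset (drop l v)"
    by (metis append_take_drop_id mset_append)+
  with * show "u \<in> words N (k + m) \<and> v \<in> words N (l + n) \<and> mset u = mset v"
    by (simp add: words_split)
qed

lemma hom_zeroI: "M \<in> match_hom N m n \<Longrightarrow> u \<notin> words N m \<or> v \<notin> words N n \<Longrightarrow> M u v = 0"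
  by (auto simp: match_hom_def)

lemma mat_mul_id_left:
  assumes "M \<in> match_hom N m n"
  shows "mat_mul N m (mat_id N m) M = M"
proof (intro ext)
  fix u v
  have "mat_mul N m (mat_id N m) M u v = (\<Sum>w\<in>words N m. if w = u then M u v else 0)"
    unfolding mat_mul_def mat_id_def by (intro sum.cong) auto
  then show "mat_mul N m (mat_id N m) M u v = M u v"
    using hom_zeroI[OF assms] by simp
qed

lemma mat_mul_id_right:
  assumes "M \<in> match_hom N m n"
  shows "mat_mul N n M (mat_id N n) = M"
proof (intro ext)
  fix u v
  have "mat_mul N n M (mat_id N n) u v = (\<Sum>w\<in>words N n. if w = v then M u v else 0)"
    unfolding mat_mul_def mat_id_def by (intro sum.cong) auto
  then show "mat_mul N n M (mat_id N n) u v = M u v"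
    using hom_zeroI[OF assms] by simp
qed

lemma mat_mul_assoc:
  "mat_mul N n (mat_mul N m L M) M' = mat_mul N m L (mat_mul N n M M')"
proof (intro ext)
  fix u v
  have "mat_mul N n (mat_mul N m L M) M' u v
      = (\<Sum>w\<in>words N n. \<Sum>w'\<in>words N m. L u w' * M w' w * M' w v)"
    by (simp add: mat_mul_def sum_distrib_right)
  also have "\<dots> = (\<Sum>w'\<in>words N m. \<Sum>w\<in>words N n. L u w' * M w' w * M' w v)"
    by (rule sum.swap)
  also have "\<dots> = mat_mul N m L (mat_mul N n M M') u v"
    by (simp add: mat_mul_def sum_distrib_left mult.assoc)
  finally show "mat_mul N n (mat_mul N m L M) M' u v = mat_mul N m L (mat_mul N n M M') u v" .
qed

lemma mat_tens_assoc:
  "mat_tens (k + m) (l + n) (mat_tens k l L M) M' = mat_tens k l L (mat_tens m n M M')"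
  by (intro ext) (simp add: mat_tens_def drop_take add.commute)

lemma mat_tens_unit_left: "mat_tens 0 0 (mat_id N 0) M = M"
  by (intro ext) (simp add: mat_tens_def mat_id_def words_0)

text \<open>In contrast to the left unit, where the cut at \<open>0\<close> is always trivial, a cut
  at \<open>m\<close> loses letters of longer words; there both sides vanish because the matrices
  live on words of fixed length.\<close>

lemma mat_tens_unit_right:
  assumes "M \<in> match_hom N m n"
  shows "mat_tens m n M (mat_id N 0) = M"
proof (intro ext)
  fix u v
  show "mat_tens m n M (mat_id N 0) u v = M u v"
  proof (cases "u \<in> words N m \<and> v \<in> words N n")
    case True
    then show ?thesis
      by (auto simp: mat_tens_def mat_id_def words_def)
  next
    case False
    moreover have "mat_tens m n M (mat_id N 0) \<in> match_hom N m n"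
      using mat_tens_in_hom[OF assms mat_id_in_hom, of 0] by simp
    ultimately show ?thesis
      using hom_zeroI assms by metis
  qed
qed

lemma mat_tens_id: "mat_tens m m (mat_id N m) (mat_id N n) = mat_id N (m + n)"
proof (intro ext)
  fix u v :: "nat list"
  have "u = v \<longleftrightarrow> take m u = take m v \<and> drop m u = drop m v"
    by (metis append_take_drop_id)
  then show "mat_tens m m (mat_id N m) (mat_id N n) u v = mat_id N (m + n) u v"
    by (auto simp: mat_tens_def mat_id_def words_split)
qed

lemma mat_interchange:
  "mat_mul N (m + m') (mat_tens l m L L') (mat_tens m n M M')
     = mat_tens l n (mat_mul N m L M) (mat_mul N m' L' M')"
proof (intro ext)
  fix u v
  let ?f = "\<lambda>p q. L (take l u) p * L' (drop l u) q * (M p (take n v) * M' q (drop n v))"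
  have "mat_mul N (m + m') (mat_tens l m L L') (mat_tens m n M M') u v
      = (\<Sum>w\<in>words N (m + m'). ?f (take m w) (drop m w))"
    by (simp add: mat_mul_def mat_tens_def)
  also have "\<dots> = (\<Sum>p\<in>words N m. \<Sum>q\<in>words N m'. ?f p q)"
    by (rule sum_words_split)
  also have "\<dots> = mat_tens l n (mat_mul N m L M) (mat_mul N m' L' M') u v"
    by (simp add: mat_mul_def mat_tens_def sum_product mult.assoc mult.left_commute)
  finally show "mat_mul N (m + m') (mat_tens l m L L') (mat_tens m n M M') u v
      = mat_tens l n (mat_mul N m L M) (mat_mul N m' L' M') u v" .
qed


section \<open>Functors as solutions of the matrix relations\<close>

definition on1 :: "nat \<Rightarrow> cmat \<Rightarrow> cmat" where
  "on1 N M = mat_tens 2 2 M (mat_id N 1)"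

definition on2 :: "nat \<Rightarrow> cmat \<Rightarrow> cmat" where
  "on2 N M = mat_tens 1 1 (mat_id N 1) M"

definition mul3 :: "nat \<Rightarrow> cmat \<Rightarrow> cmat \<Rightarrow> cmat \<Rightarrow> cmat" where
  "mul3 N L M M' = mat_mul N 3 (mat_mul N 3 L M) M'"

text \<open>All four cubic relations have the shape \<open>x_1 y_2 z_1 = x'_2 y'_1 z'_2\<close>.
  With six free slots one extraction of coefficients serves them all.\<close>

definition cubic_rel ::
  "nat \<Rightarrow> cmat \<Rightarrow> cmat \<Rightarrow> cmat \<Rightarrow> cmat \<Rightarrow> cmat \<Rightarrow> cmat \<Rightarrow> bool" where
  "cubic_rel N A B C A' B' C' \<longleftrightarrow>
     mul3 N (on1 N A) (on2 N B) (on1 N C) = mul3 N (on2 N A') (on1 N B') (on2 N C')"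

definition loop_pair :: "nat \<Rightarrow> cmat \<Rightarrow> cmat \<Rightarrow> bool" where
  "loop_pair N S R \<longleftrightarrow>
     S \<in> match_hom N 2 2 \<and> R \<in> match_hom N 2 2 \<and> mat_mul N 2 S S = mat_id N 2 \<and>
     (\<exists>R'\<in>match_hom N 2 2. mat_mul N 2 R R' = mat_id N 2 \<and> mat_mul N 2 R' R = mat_id N 2) \<and>
     cubic_rel N S S S S S S \<and> cubic_rel N R R R R R R \<and>
     cubic_rel N R R S S R R \<and> cubic_rel N R S S S S R"

text \<open>The candidate functor on formal expressions. Formal inverses are separate syntax, so
  their images \<open>G'\<close> are a separate argument.\<close>

primrec ev_term :: "nat \<Rightarrow> (lgen \<Rightarrow> cmat) \<Rightarrow> (lgen \<Rightarrow> cmat) \<Rightarrow> lterm \<Rightarrow> cmat" where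
  "ev_term N G G' (LId n) = mat_id N n"
| "ev_term N G G' (LGen g) = G g"
| "ev_term N G G' (LInv g) = G' g"
| "ev_term N G G' (LCmp t u) = mat_mul N (arity t) (ev_term N G G' t) (ev_term N G G' u)"
| "ev_term N G G' (LTens t u) = mat_tens (arity t) (arity t) (ev_term N G G' t) (ev_term N G G' u)"

lemma ev_term_in_hom:
  assumes "\<And>g. G g \<in> match_hom N 2 2" "\<And>g. G' g \<in> match_hom N 2 2"
  shows "wf_lterm t \<Longrightarrow> ev_term N G G' t \<in> match_hom N (arity t) (arity t)"
proof (induction t)
  case (LCmp t u)
  then have "ev_term N G G' t \<in> match_hom N (arity t) (arity t)"
    "ev_term N G G' u \<in> match_hom N (arity t) (arity t)"
    by auto
  then show ?case
    by (simp add: mat_mul_in_hom)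
next
  case (LTens t u)
  then show ?case
    by (simp add: mat_tens_in_hom)
next
  case (LId n)
  show ?case
    by (simp add: mat_id_in_hom)
next
  case (LGen g)
  show ?case
    using assms(1) by simp
next
  case (LInv g)
  show ?case
    using assms(2) by simp
qed

lemma lrel_imp_wf:
  "lrel t u \<Longrightarrow> wf_lterm t \<and> wf_lterm u \<and> arity t = arity u"
  by (induction rule: lrel.induct) (simp_all add: cmp3_def at1_def at2_def)

lemma at_simps [simp]:
  "wf_lterm (at1 g)" "wf_lterm (at2 g)" "arity (at1 g) = 3" "arity (at2 g) = 3"
  "ev_term N G G' (at1 g) = on1 N (G g)" "ev_term N G G' (at2 g) = on2 N (G g)"
  by (simp_all add: at1_def at2_def on1_def on2_def)

lemma ev_term_cmp3 [simp]:
  assumes "arity t = 3" "arity u = 3" "arity v = 3"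
  shows "ev_term N G G' (cmp3 t u v) = mul3 N (ev_term N G G' t) (ev_term N G G' u) (ev_term N G G' v)"
  using assms by (simp add: cmp3_def mul3_def)

text \<open>Soundness of the presentation: the monoidal axioms hold for matrices, the inverse laws
  are assumed of \<open>G\<close> and \<open>G'\<close>, and the defining relations are clauses of
  \<open>loop_pair\<close>.\<close>

lemma ev_term_cong:
  assumes "\<And>g. G g \<in> match_hom N 2 2" "\<And>g. G' g \<in> match_hom N 2 2"
    and "\<And>g. mat_mul N 2 (G g) (G' g) = mat_id N 2" "\<And>g. mat_mul N 2 (G' g) (G g) = mat_id N 2"
    and pair: "loop_pair N (G Swap) (G Sigma)"
  shows "lrel t u \<Longrightarrow> ev_term N G G' t = ev_term N G G' u"
proof (induction rule: lrel.induct)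
  case (lrel_cmp t t' u u')
  then show ?case
    using lrel_imp_wf[of t t'] by simp
next
  case (lrel_tens t t' u u')
  then show ?case
    using lrel_imp_wf[of t t'] by simp
next
  case (id_left t)
  then show ?case
    using mat_mul_id_left[OF ev_term_in_hom[where G = G and G' = G', OF assms(1,2) id_left]] by simp
next
  case (id_right t)
  then show ?case
    using mat_mul_id_right[OF ev_term_in_hom[where G = G and G' = G', OF assms(1,2) id_right]] by simp
next
  case (tens_unit_right t)
  then show ?case
    using mat_tens_unit_right[OF ev_term_in_hom[where G = G and G' = G', OF assms(1,2) tens_unit_right]] by simp
next
  case (interchange t u t' u')
  then show ?case
    by (simp add: mat_interchange)
next
  case (cmp_assoc t u v)
  then show ?case
    by (simp add: mat_mul_assoc)
next
  case (tens_assoc t u v)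
  then show ?case
    by (simp add: mat_tens_assoc)
next
  case swap_invol
  then show ?case
    using pair mat_tens_id[of 1 N 1, unfolded one_add_one] by (simp add: loop_pair_def)
next
  case swap_braid
  then show ?case
    using pair by (simp add: loop_pair_def cubic_rel_def)
next
  case rel_I
  then show ?case
    using pair by (simp add: loop_pair_def cubic_rel_def)
next
  case rel_II
  then show ?case
    using pair by (simp add: loop_pair_def cubic_rel_def)
next
  case rel_III
  then show ?case
    using pair by (simp add: loop_pair_def cubic_rel_def)
qed (simp_all add: assms(3,4) mat_tens_unit_left mat_tens_id)

section \<open>Operations on classes of expressions, and functors out of the presented
  category\<close>

lemma lclass_eq: "lrel t u \<Longrightarrow> lclass t = lclass u"
  unfolding lclass_def by (auto intro: lrel_sym lrel_trans)

lemma mem_lclass [simp]: "u \<in> lclass t \<longleftrightarrow> lrel t u"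
  by (simp add: lclass_def)

lemma Hom_LoopBraid:
  "Hom LoopBraid m n = (if m = n then {lclass t | t. wf_lterm t \<and> arity t = n} else {})"
  and Ident_LoopBraid [simp]: "Ident LoopBraid n = lclass (LId n)"
  by (simp_all add: LoopBraid_def)

lemma Hom_LoopBraidE:
  assumes "f \<in> Hom LoopBraid m n"
  obtains t where "wf_lterm t" "arity t = n" "m = n" "f = lclass t"
  using assms unfolding Hom_LoopBraid by (auto split: if_splits)

text \<open>The operation is a union over all representatives. The congruence rules make every
  member of the union the same class, and reflexivity provides at least one.\<close>

lemma Cmp_LoopBraid [simp]:
  assumes "wf_lterm t" "wf_lterm u" "arity t = arity u"
  shows "Cmp LoopBraid l m n (lclass t) (lclass u) = lclass (LCmp t u)"
proof -
  have "lclass (LCmp t' u') = lclass (LCmp t u)" if "lrel t t'" "lrel u u'" for t' u'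
    using that assms by (metis lclass_eq lrel_cmp)
  then have "(\<Union>t'\<in>lclass t. \<Union>u'\<in>lclass u. lclass (LCmp t' u'))
      = (\<Union>t'\<in>lclass t. \<Union>u'\<in>lclass u. lclass (LCmp t u))"
    by (intro SUP_cong refl) simp
  moreover have "t \<in> lclass t" "u \<in> lclass u"
    using assms by (auto intro: lrel_refl)
  ultimately show ?thesis
    unfolding LoopBraid_def by auto
qed

lemma Tens_LoopBraid [simp]:
  assumes "wf_lterm t" "wf_lterm u"
  shows "Tens LoopBraid k l m n (lclass t) (lclass u) = lclass (LTens t u)"
proof -
  have "lclass (LTens t' u') = lclass (LTens t u)" if "lrel t t'" "lrel u u'" for t' u'
    using that by (metis lclass_eq lrel_tens)
  then have "(\<Union>t'\<in>lclass t. \<Union>u'\<in>lclass u. lclass (LTens t' u'))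
      = (\<Union>t'\<in>lclass t. \<Union>u'\<in>lclass u. lclass (LTens t u))"
    by (intro SUP_cong refl) simp
  moreover have "t \<in> lclass t" "u \<in> lclass u"
    using assms by (auto intro: lrel_refl)
  ultimately show ?thesis
    unfolding LoopBraid_def by auto
qed

lemma Match_simps [simp]:
  "Hom (Match N) = match_hom N" "Ident (Match N) = mat_id N"
  "Cmp (Match N) l m n = mat_mul N m" "Tens (Match N) k l m n = mat_tens k l"
  by (simp_all add: Match_def)

lemma gives_functorI:
  assumes pair: "loop_pair N S R"
  shows "gives_functor N (S, R)"
proof -
  from pair obtain R' where R': "R' \<in> match_hom N 2 2"
      "mat_mul N 2 R R' = mat_id N 2" "mat_mul N 2 R' R = mat_id N 2"
    by (auto simp: loop_pair_def)
  define G where "G g = (case g of Sigma \<Rightarrow> R | Swap \<Rightarrow> S)" for g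
  define G' where "G' g = (case g of Sigma \<Rightarrow> R' | Swap \<Rightarrow> S)" for g
  have hom: "\<And>g. G g \<in> match_hom N 2 2" "\<And>g. G' g \<in> match_hom N 2 2"
    using pair R' by (auto simp: G_def G'_def loop_pair_def split: lgen.split)
  have cong: "lrel t u \<Longrightarrow> ev_term N G G' t = ev_term N G G' u" for t u
    by (rule ev_term_cong[where G = G and G' = G', OF hom])
      (use pair R' in \<open>auto simp: G_def G'_def loop_pair_def split: lgen.split\<close>)
  \<comment> \<open>An arbitrary representative is evaluated; soundness makes the choice
    irrelevant.\<close>
  define F where "F m n f = ev_term N G G' (SOME t. t \<in> f)" for m n :: nat and f
  have F: "F m n (lclass t) = ev_term N G G' t" if "wf_lterm t" for m n t
  proof -
    have "lrel t (SOME t'. t' \<in> lclass t)"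
      using someI_ex[of "\<lambda>t'. t' \<in> lclass t"] lrel_refl[OF that] by auto
    then show ?thesis
      unfolding F_def using cong by simp
  qed
  have "strict_monoidal_functor LoopBraid (Match N) id F"
    unfolding strict_monoidal_functor_def
    by (auto elim!: Hom_LoopBraidE simp: F intro!: ev_term_in_hom[where G = G and G' = G', OF hom])
  moreover have "gen_images F = (S, R)"
    by (simp add: gen_images_def F G_def)
  ultimately show ?thesis
    unfolding gives_functor_def charge_conserving_functor_def by fastforce
qed

lemma functor_imp_loop_pair:
  assumes "charge_conserving_functor N FO F"
  shows "loop_pair N (fst (gen_images F)) (snd (gen_images F))"
proof -
  have SMF: "strict_monoidal_functor LoopBraid (Match N) FO F" and "FO 1 = 1"
    using assms by (auto simp: charge_conserving_functor_def)
  then have add: "FO (m + n) = FO m + FO n" and "FO 0 = 0" for m n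
    by (auto simp: strict_monoidal_functor_def)
  \<comment> \<open>Additivity together with \<open>FO 1 = 1\<close> leaves only the identity on
    objects.\<close>
  have FO: "FO n = n" for n
  proof (induction n)
    case (Suc n)
    then show ?case
      using add[of n 1] \<open>FO 1 = 1\<close> by simp
  qed (rule \<open>FO 0 = 0\<close>)
  \<comment> \<open>Pulling the functor back to expressions turns each defining relation directly
    into a matrix equation.\<close>
  define E where "E t = F (arity t) (arity t) (lclass t)" for t
  have E_hom: "E t \<in> match_hom N (arity t) (arity t)" if "wf_lterm t" for t
  proof -
    have "lclass t \<in> Hom LoopBraid (arity t) (arity t)"
      using that by (auto simp: Hom_LoopBraid)
    then show ?thesis
      using SMF unfolding strict_monoidal_functor_def E_def by (simp add: FO)
  qed
  have E_id: "E (LId n) = mat_id N n" for n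
    using SMF unfolding strict_monoidal_functor_def E_def by (auto simp: FO)
  have E_cmp: "E (LCmp t u) = mat_mul N (arity t) (E t) (E u)"
    if "wf_lterm t" "wf_lterm u" "arity t = arity u" for t u
  proof -
    have "lclass t \<in> Hom LoopBraid (arity t) (arity t)" "lclass u \<in> Hom LoopBraid (arity t) (arity t)"
      using that by (auto simp: Hom_LoopBraid)
    then have "F (arity t) (arity t) (Cmp LoopBraid (arity t) (arity t) (arity t) (lclass t) (lclass u))
        = mat_mul N (arity t) (E t) (E u)"
      using SMF that(3) unfolding strict_monoidal_functor_def E_def by (simp add: FO)
    then show ?thesis
      using that by (simp add: E_def)
  qed
  have E_tens: "E (LTens t u) = mat_tens (arity t) (arity t) (E t) (E u)"
    if "wf_lterm t" "wf_lterm u" for t u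
  proof -
    have "lclass t \<in> Hom LoopBraid (arity t) (arity t)" "lclass u \<in> Hom LoopBraid (arity u) (arity u)"
      using that by (auto simp: Hom_LoopBraid)
    then have "F (arity t + arity u) (arity t + arity u)
          (Tens LoopBraid (arity t) (arity t) (arity u) (arity u) (lclass t) (lclass u))
        = mat_tens (arity t) (arity t) (E t) (E u)"
      using SMF unfolding strict_monoidal_functor_def E_def by (simp add: FO)
    then show ?thesis
      using that by (simp add: E_def)
  qed
  have E_rel: "E t = E u" if "lrel t u" for t u
    unfolding E_def using lclass_eq[OF that] lrel_imp_wf[OF that] by simp
  have gen: "gen_images F = (E (LGen Swap), E (LGen Sigma))"
    by (simp add: gen_images_def E_def)
  have E_at: "E (at1 g) = on1 N (E (LGen g))" "E (at2 g) = on2 N (E (LGen g))" for g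
    by (simp_all add: at1_def at2_def on1_def on2_def E_tens E_id)
  have E_cmp3: "E (cmp3 t u v) = mul3 N (E t) (E u) (E v)"
    if "wf_lterm t" "wf_lterm u" "wf_lterm v" "arity t = 3" "arity u = 3" "arity v = 3" for t u v
    using that by (simp add: cmp3_def mul3_def E_cmp)
  note rels = swap_braid rel_I rel_II rel_III
  have "cubic_rel N (E (LGen Swap)) (E (LGen Swap)) (E (LGen Swap))
      (E (LGen Swap)) (E (LGen Swap)) (E (LGen Swap))"
    "cubic_rel N (E (LGen Sigma)) (E (LGen Sigma)) (E (LGen Sigma))
      (E (LGen Sigma)) (E (LGen Sigma)) (E (LGen Sigma))"
    "cubic_rel N (E (LGen Sigma)) (E (LGen Sigma)) (E (LGen Swap))
      (E (LGen Swap)) (E (LGen Sigma)) (E (LGen Sigma))"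
    "cubic_rel N (E (LGen Sigma)) (E (LGen Swap)) (E (LGen Swap))
      (E (LGen Swap)) (E (LGen Swap)) (E (LGen Sigma))"
    using rels[THEN E_rel] by (simp_all add: cubic_rel_def E_cmp3 E_at)
  moreover have "mat_mul N 2 (E (LGen Swap)) (E (LGen Swap)) = mat_id N 2"
    using E_rel[OF swap_invol] mat_tens_id[of 1 N 1, unfolded one_add_one] by (simp add: E_cmp E_tens E_id)
  moreover have "mat_mul N 2 (E (LGen Sigma)) (E (LInv Sigma)) = mat_id N 2"
      "mat_mul N 2 (E (LInv Sigma)) (E (LGen Sigma)) = mat_id N 2"
    using E_rel[OF inv_right[of Sigma]] E_rel[OF inv_left[of Sigma]] by (simp_all add: E_cmp E_id)
  moreover have "E (LGen g) \<in> match_hom N 2 2" "E (LInv g) \<in> match_hom N 2 2" for g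
    using E_hom[of "LGen g"] E_hom[of "LInv g"] by simp_all
  ultimately show ?thesis
    unfolding gen loop_pair_def by auto
qed


section \<open>Coefficients of the cubic relations\<close>

definition dg :: "cmat \<Rightarrow> nat \<Rightarrow> nat \<Rightarrow> complex" where
  "dg M x y = M [x, y] [x, y]"

text \<open>On equal letters the single entry is counted as diagonal.\<close>

definition off :: "cmat \<Rightarrow> nat \<Rightarrow> nat \<Rightarrow> complex" where
  "off M x y = (if x = y then 0 else M [x, y] [y, x])"

lemma off_same [simp]: "off M x x = 0"
  by (simp add: off_def)

lemma words_2: "words N 2 = {[x, y] | x y. x \<in> {1..N} \<and> y \<in> {1..N}}"
  by (auto simp: words_def length_Suc_conv numeral_2_eq_2)

lemma words_3: "words N 3 = {[x, y, z] | x y z. x \<in> {1..N} \<and> y \<in> {1..N} \<and> z \<in> {1..N}}"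
  by (auto simp: words_def length_Suc_conv numeral_3_eq_3)

lemma mem_words [simp]:
  "[x, y] \<in> words N 2 \<longleftrightarrow> x \<in> {1..N} \<and> y \<in> {1..N}"
  "[x, y, z] \<in> words N 3 \<longleftrightarrow> x \<in> {1..N} \<and> y \<in> {1..N} \<and> z \<in> {1..N}"
  by (simp_all add: words_def)

lemma mset_pair_eq:
  "mset [x, y] = mset w \<longleftrightarrow> w = [x, y] \<or> w = [y, x]"
proof
  assume *: "mset [x, y] = mset w"
  then have "length w = 2"
    by (metis length_Cons list.size(3) mset_eq_length numeral_2_eq_2)
  then obtain a b where "w = [a, b]"
    by (auto simp: length_Suc_conv numeral_2_eq_2)
  with * show "w = [x, y] \<or> w = [y, x]"
    by (auto simp: add_eq_conv_ex)
qed auto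

text \<open>A multiple of a basis row vector. Rows of charge-conserving matrices are short sums of
  these, also when letters coincide, so products are computed row by row.\<close>

definition at_word :: "nat list \<Rightarrow> complex \<Rightarrow> nat list \<Rightarrow> complex" where
  "at_word v c w = (if w = v then c else 0)"

lemma at_word_simps [simp]:
  "at_word v c v = c" "at_word v 0 w = 0" "w \<noteq> v \<Longrightarrow> at_word v c w = 0"
  by (simp_all add: at_word_def)

lemma at_word_add: "at_word v (c + d) w = at_word v c w + at_word v d w"
  and at_word_mult: "e * at_word v c w = at_word v (e * c) w"
  by (simp_all add: at_word_def)

lemma sum_at_word: "v \<in> words N n \<Longrightarrow> (\<Sum>u\<in>words N n. at_word v c u) = c"
  by (simp add: at_word_def)

lemma row_2:
  assumes "M \<in> match_hom N 2 2"
  shows "M [x, y] w = at_word [x, y] (dg M x y) w + at_word [y, x] (off M x y) w"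
proof (cases "w = [x, y] \<or> w = [y, x]")
  case False
  then have "mset [x, y] \<noteq> mset w"
    unfolding mset_pair_eq .
  then have "M [x, y] w = 0"
    using assms unfolding match_hom_def by blast
  with False show ?thesis
    by simp
next
  case True
  then show ?thesis
    by (cases "x = y") (auto simp: dg_def off_def)
qed

lemma match_hom_2_eqI:
  assumes "M \<in> match_hom N 2 2" "M' \<in> match_hom N 2 2"
    and "\<And>x y. x \<in> {1..N} \<Longrightarrow> y \<in> {1..N} \<Longrightarrow> dg M x y = dg M' x y \<and> off M x y = off M' x y"
  shows "M = M'"
proof (intro ext)
  fix u w
  show "M u w = M' u w"
  proof (cases "u \<in> words N 2")
    case True
    then obtain x y where u: "u = [x, y]" and xy: "x \<in> {1..N}" "y \<in> {1..N}"
      by (auto simp: words_2)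
    show ?thesis
      unfolding u using assms(3)[OF xy]
      by (simp only: row_2[OF assms(1), of x y] row_2[OF assms(2), of x y])
  next
    case False
    then show ?thesis
      using hom_zeroI[OF assms(1)] hom_zeroI[OF assms(2)] by simp
  qed
qed

text \<open>\<open>M\<close> acts on the first two letters, so only two rows of \<open>Q\<close>
  enter. \<open>Q\<close> is arbitrary, which lets the rule be iterated from the left.\<close>

lemma mul_on1_row:
  assumes "M \<in> match_hom N 2 2" "x \<in> {1..N}" "y \<in> {1..N}" "z \<in> {1..N}"
  shows "mat_mul N 3 (on1 N M) Q [x, y, z] w = dg M x y * Q [x, y, z] w + off M x y * Q [y, x, z] w"
proof -
  have row: "on1 N M [x, y, z] v = at_word [x, y, z] (dg M x y) v + at_word [y, x, z] (off M x y) v" for v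
  proof -
    have "v = [a, b, z] \<longleftrightarrow> take 2 v = [a, b] \<and> drop 2 v = [z]" for a b
      by (metis append_Cons append_Nil append_take_drop_id drop_Suc_Cons drop_0 numeral_2_eq_2 take_0 take_Suc_Cons)
    then have "at_word [a, b, z] c v = at_word [a, b] c (take 2 v) * mat_id N 1 [z] (drop 2 v)" for a b c
      using assms(4) by (auto simp: at_word_def mat_id_def words_def)
    then show ?thesis
      by (simp add: on1_def on2_def mat_tens_def row_2[OF assms(1)] distrib_right)
  qed
  have "mat_mul N 3 (on1 N M) Q [x, y, z] w
      = (\<Sum>v\<in>words N 3. at_word [x, y, z] (dg M x y * Q [x, y, z] w) v
          + at_word [y, x, z] (off M x y * Q [y, x, z] w) v)"
    unfolding mat_mul_def row distrib_right by (intro sum.cong arg_cong2[where f = plus]) (auto simp: at_word_def)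
  then show ?thesis
    using assms(2-4) by (simp add: sum.distrib sum_at_word)
qed

lemma mul_on2_row:
  assumes "M \<in> match_hom N 2 2" "x \<in> {1..N}" "y \<in> {1..N}" "z \<in> {1..N}"
  shows "mat_mul N 3 (on2 N M) Q [x, y, z] w = dg M y z * Q [x, y, z] w + off M y z * Q [x, z, y] w"
proof -
  have row: "on2 N M [x, y, z] v = at_word [x, y, z] (dg M y z) v + at_word [x, z, y] (off M y z) v" for v
  proof -
    have "v = [x, a, b] \<longleftrightarrow> take 1 v = [x] \<and> drop 1 v = [a, b]" for a b
      by (cases v) auto
    then have "at_word [x, a, b] c v = mat_id N 1 [x] (take 1 v) * at_word [a, b] c (drop 1 v)" for a b c
      using assms(2) by (auto simp: at_word_def mat_id_def words_def)
    then show ?thesis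
      by (simp add: on1_def on2_def mat_tens_def row_2[OF assms(1)] distrib_left)
  qed
  have "mat_mul N 3 (on2 N M) Q [x, y, z] w
      = (\<Sum>v\<in>words N 3. at_word [x, y, z] (dg M y z * Q [x, y, z] w) v
          + at_word [x, z, y] (off M y z * Q [x, z, y] w) v)"
    unfolding mat_mul_def row distrib_right by (intro sum.cong arg_cong2[where f = plus]) (auto simp: at_word_def)
  then show ?thesis
    using assms(2-4) by (simp add: sum.distrib sum_at_word)
qed

lemma on_in_hom:
  assumes "M \<in> match_hom N 2 2"
  shows "on1 N M \<in> match_hom N 3 3" "on2 N M \<in> match_hom N 3 3"
  using mat_tens_in_hom[OF assms mat_id_in_hom[of N 1]] mat_tens_in_hom[OF mat_id_in_hom[of N 1] assms]
  by (simp_all add: on1_def on2_def numeral_3_eq_3)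

lemma mul3_in_hom:
  "L \<in> match_hom N 3 3 \<Longrightarrow> M \<in> match_hom N 3 3 \<Longrightarrow> M' \<in> match_hom N 3 3 \<Longrightarrow>
    mul3 N L M M' \<in> match_hom N 3 3"
  unfolding mul3_def by (intro mat_mul_in_hom)

text \<open>Letters may coincide here: equal words then simply collect their coefficients, and
  \<open>off M x x = 0\<close> avoids double counting.\<close>

lemma mul3_121:
  assumes "A \<in> match_hom N 2 2" "B \<in> match_hom N 2 2" "C \<in> match_hom N 2 2"
    and "x \<in> {1..N}" "y \<in> {1..N}" "z \<in> {1..N}"
  shows "mul3 N (on1 N A) (on2 N B) (on1 N C) [x, y, z] w =
      at_word [x, y, z] (dg A x y * dg B y z * dg C x y + off A x y * dg B x z * off C y x) w
    + at_word [y, x, z] (dg A x y * dg B y z * off C x y + off A x y * dg B x z * dg C y x) w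
    + at_word [x, z, y] (dg A x y * off B y z * dg C x z) w
    + at_word [z, x, y] (dg A x y * off B y z * off C x z) w
    + at_word [y, z, x] (off A x y * off B x z * dg C y z) w
    + at_word [z, y, x] (off A x y * off B x z * off C y z) w"
proof -
  \<comment> \<open>An identity is appended on the right so that the row rule also applies to the
    last factor.\<close>
  have "mul3 N (on1 N A) (on2 N B) (on1 N C)
      = mat_mul N 3 (on1 N A) (mat_mul N 3 (on2 N B) (mat_mul N 3 (on1 N C) (mat_id N 3)))"
    by (simp only: mul3_def mat_mul_assoc mat_mul_id_right[OF on_in_hom(1)[OF assms(3)]])
  moreover have "mat_id N 3 [a, b, c] w = at_word [a, b, c] 1 w"
    if "a \<in> {1..N}" "b \<in> {1..N}" "c \<in> {1..N}" for a b c
    using that by (auto simp: mat_id_def words_def at_word_def)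
  ultimately show ?thesis
    by (simp only: mul_on1_row[OF assms(1)] mul_on1_row[OF assms(3)] mul_on2_row[OF assms(2)] assms(4-6))
      (simp add: distrib_left at_word_mult at_word_add mult.assoc)
qed

lemma mul3_212:
  assumes "A \<in> match_hom N 2 2" "B \<in> match_hom N 2 2" "C \<in> match_hom N 2 2"
    and "x \<in> {1..N}" "y \<in> {1..N}" "z \<in> {1..N}"
  shows "mul3 N (on2 N A) (on1 N B) (on2 N C) [x, y, z] w =
      at_word [x, y, z] (dg A y z * dg B x y * dg C y z + off A y z * dg B x z * off C z y) w
    + at_word [y, x, z] (dg A y z * off B x y * dg C x z) w
    + at_word [x, z, y] (dg A y z * dg B x y * off C y z + off A y z * dg B x z * dg C z y) w
    + at_word [z, x, y] (off A y z * off B x z * dg C x y) w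
    + at_word [y, z, x] (dg A y z * off B x y * off C x z) w
    + at_word [z, y, x] (off A y z * off B x z * off C x y) w"
proof -
  have "mul3 N (on2 N A) (on1 N B) (on2 N C)
      = mat_mul N 3 (on2 N A) (mat_mul N 3 (on1 N B) (mat_mul N 3 (on2 N C) (mat_id N 3)))"
    by (simp only: mul3_def mat_mul_assoc mat_mul_id_right[OF on_in_hom(2)[OF assms(3)]])
  moreover have "mat_id N 3 [a, b, c] w = at_word [a, b, c] 1 w"
    if "a \<in> {1..N}" "b \<in> {1..N}" "c \<in> {1..N}" for a b c
    using that by (auto simp: mat_id_def words_def at_word_def)
  ultimately show ?thesis
    by (simp only: mul_on2_row[OF assms(1)] mul_on2_row[OF assms(3)] mul_on1_row[OF assms(2)] assms(4-6))
      (simp add: distrib_left at_word_mult at_word_add mult.assoc)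
qed

definition cubic_eqs ::
  "cmat \<Rightarrow> cmat \<Rightarrow> cmat \<Rightarrow> cmat \<Rightarrow> cmat \<Rightarrow> cmat \<Rightarrow> nat \<Rightarrow> nat \<Rightarrow> nat \<Rightarrow> bool" where
  "cubic_eqs A B C A' B' C' x y z \<longleftrightarrow>
     dg A x y * dg B y z * dg C x y + off A x y * dg B x z * off C y x
       = dg A' y z * dg B' x y * dg C' y z + off A' y z * dg B' x z * off C' z y \<and>
     dg A x y * dg B y z * off C x y + off A x y * dg B x z * dg C y x
       = dg A' y z * off B' x y * dg C' x z \<and>
     dg A x y * off B y z * dg C x z
       = dg A' y z * dg B' x y * off C' y z + off A' y z * dg B' x z * dg C' z y \<and>
     dg A x y * off B y z * off C x z = off A' y z * off B' x z * dg C' x y \<and>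
     off A x y * off B x z * dg C y z = dg A' y z * off B' x y * off C' x z \<and>
     off A x y * off B x z * off C y z = off A' y z * off B' x z * off C' x y"

text \<open>Comparing coefficients of the six formal rearrangements suffices even when repeated
  letters make some of them equal. The converse is split below according to whether letters
  repeat.\<close>

lemma cubic_relI:
  assumes hom: "A \<in> match_hom N 2 2" "B \<in> match_hom N 2 2" "C \<in> match_hom N 2 2"
      "A' \<in> match_hom N 2 2" "B' \<in> match_hom N 2 2" "C' \<in> match_hom N 2 2"
    and eqs: "\<And>x y z. x \<in> {1..N} \<Longrightarrow> y \<in> {1..N} \<Longrightarrow> z \<in> {1..N} \<Longrightarrow> cubic_eqs A B C A' B' C' x y z"
  shows "cubic_rel N A B C A' B' C'"
  unfolding cubic_rel_def
proof (intro ext)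
  fix u w
  show "mul3 N (on1 N A) (on2 N B) (on1 N C) u w = mul3 N (on2 N A') (on1 N B') (on2 N C') u w"
  proof (cases "u \<in> words N 3")
    case True
    then obtain x y z where u: "u = [x, y, z]" "x \<in> {1..N}" "y \<in> {1..N}" "z \<in> {1..N}"
      by (auto simp: words_3)
    from eqs[OF u(2-4)] show ?thesis
      unfolding u(1) mul3_121[OF hom(1-3) u(2-4)] mul3_212[OF hom(4-6) u(2-4)] cubic_eqs_def
      by simp
  next
    case False
    moreover have "mul3 N (on1 N A) (on2 N B) (on1 N C) \<in> match_hom N 3 3"
        "mul3 N (on2 N A') (on1 N B') (on2 N C') \<in> match_hom N 3 3"
      using hom by (simp_all add: mul3_in_hom on_in_hom)
    ultimately show ?thesis
      by (simp add: hom_zeroI)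
  qed
qed

text \<open>Distinct letters have six different rearrangements, so each coefficient can be isolated
  by evaluating at one word.\<close>

lemma cubic_rel_eqs:
  assumes "cubic_rel N A B C A' B' C'"
    and "A \<in> match_hom N 2 2" "B \<in> match_hom N 2 2" "C \<in> match_hom N 2 2"
      "A' \<in> match_hom N 2 2" "B' \<in> match_hom N 2 2" "C' \<in> match_hom N 2 2"
    and "x \<in> {1..N}" "y \<in> {1..N}" "z \<in> {1..N}" and distinct: "x \<noteq> y" "y \<noteq> z" "x \<noteq> z"
  shows "cubic_eqs A B C A' B' C' x y z"
proof -
  have eq: "mul3 N (on1 N A) (on2 N B) (on1 N C) [x, y, z] w
      = mul3 N (on2 N A') (on1 N B') (on2 N C') [x, y, z] w" for w
    using assms(1) by (simp add: cubic_rel_def)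
  note eq = eq[unfolded mul3_121[OF assms(2-4,8-10)] mul3_212[OF assms(5-10)]]
  show ?thesis
    unfolding cubic_eqs_def
    using eq[of "[x, y, z]"] eq[of "[y, x, z]"] eq[of "[x, z, y]"] eq[of "[z, x, y]"]
      eq[of "[y, z, x]"] eq[of "[z, y, x]"] distinct distinct[symmetric]
    by simp
qed

text \<open>On \<open>xxy\<close>, \<open>xyx\<close> and \<open>yxx\<close> rearrangements coincide
  and their coefficients add up. Six of the nine resulting entries are recorded, two for each
  row.\<close>

lemma cubic_rel_two_letters:
  assumes "cubic_rel N A B C A' B' C'"
    and "A \<in> match_hom N 2 2" "B \<in> match_hom N 2 2" "C \<in> match_hom N 2 2"
      "A' \<in> match_hom N 2 2" "B' \<in> match_hom N 2 2" "C' \<in> match_hom N 2 2"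
    and "x \<in> {1..N}" "y \<in> {1..N}" "x \<noteq> y"
  shows
    "dg A x x * dg B x y * dg C x x
       = dg A' x y * dg B' x x * dg C' x y + off A' x y * dg B' x y * off C' y x"
    "dg A x x * off B x y * dg C x y
       = dg A' x y * dg B' x x * off C' x y + off A' x y * dg B' x y * dg C' y x"
    "dg A x y * dg B y x * off C x y + off A x y * dg B x x * dg C y x
       = dg A' y x * off B' x y * dg C' x x"
    "dg A x y * dg B y x * dg C x y + off A x y * dg B x x * off C y x
       = dg A' y x * dg B' x y * dg C' y x + off A' y x * dg B' x x * off C' x y"
    "dg A y x * dg B x x * dg C y x + off A y x * dg B y x * off C x y
       = dg A' x x * dg B' y x * dg C' x x"
    "dg A y x * dg B x x * off C y x + off A y x * dg B y x * dg C x y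
       = dg A' x x * off B' y x * dg C' y x"
proof -
  have eq: "mul3 N (on1 N A) (on2 N B) (on1 N C) u w
      = mul3 N (on2 N A') (on1 N B') (on2 N C') u w" for u w
    using assms(1) by (simp add: cubic_rel_def)
  note eq1 = eq[of "[x, x, y]", unfolded mul3_121[OF assms(2-4,8,8,9)] mul3_212[OF assms(5-7,8,8,9)]]
  note eq2 = eq[of "[x, y, x]", unfolded mul3_121[OF assms(2-4,8,9,8)] mul3_212[OF assms(5-7,8,9,8)]]
  note eq3 = eq[of "[y, x, x]", unfolded mul3_121[OF assms(2-4,9,8,8)] mul3_212[OF assms(5-7,9,8,8)]]
  note ne = assms(10) assms(10)[symmetric]
  show "dg A x x * dg B x y * dg C x x
       = dg A' x y * dg B' x x * dg C' x y + off A' x y * dg B' x y * off C' y x"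
    "dg A x x * off B x y * dg C x y
       = dg A' x y * dg B' x x * off C' x y + off A' x y * dg B' x y * dg C' y x"
    using eq1[of "[x, x, y]"] eq1[of "[x, y, x]"] ne by simp_all
  show "dg A x y * dg B y x * off C x y + off A x y * dg B x x * dg C y x
       = dg A' y x * off B' x y * dg C' x x"
    "dg A x y * dg B y x * dg C x y + off A x y * dg B x x * off C y x
       = dg A' y x * dg B' x y * dg C' y x + off A' y x * dg B' x x * off C' x y"
    using eq2[of "[y, x, x]"] eq2[of "[x, y, x]"] ne by simp_all
  show "dg A y x * dg B x x * dg C y x + off A y x * dg B y x * off C x y
       = dg A' x x * dg B' y x * dg C' x x"
    "dg A y x * dg B x x * off C y x + off A y x * dg B y x * dg C x y
       = dg A' x x * off B' y x * dg C' y x"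
    using eq3[of "[y, x, x]"] eq3[of "[x, y, x]"] ne by simp_all
qed


section \<open>Two-letter products, inverses and determinants, block by block\<close>

lemma coeffs_id:
  assumes "x \<in> {1..N}" "y \<in> {1..N}"
  shows "dg (mat_id N 2) x y = 1" "off (mat_id N 2) x y = 0"
  using assms by (simp_all add: dg_def off_def mat_id_def)

lemma coeffs_mul:
  assumes "M \<in> match_hom N 2 2" "M' \<in> match_hom N 2 2" "x \<in> {1..N}" "y \<in> {1..N}"
  shows "dg (mat_mul N 2 M M') x y = dg M x y * dg M' x y + off M x y * off M' y x"
    and "x \<noteq> y \<Longrightarrow> off (mat_mul N 2 M M') x y = dg M x y * off M' x y + off M x y * dg M' y x"
proof -
  have row: "mat_mul N 2 M M' [x, y] w = dg M x y * M' [x, y] w + off M x y * M' [y, x] w" for w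
  proof -
    have "mat_mul N 2 M M' [x, y] w = (\<Sum>v\<in>words N 2. at_word [x, y] (dg M x y * M' [x, y] w) v
        + at_word [y, x] (off M x y * M' [y, x] w) v)"
      unfolding mat_mul_def row_2[OF assms(1)] distrib_right
      by (intro sum.cong arg_cong2[where f = plus]) (auto simp: at_word_def)
    then show ?thesis
      using assms(3,4) by (simp add: sum.distrib sum_at_word)
  qed
  show "dg (mat_mul N 2 M M') x y = dg M x y * dg M' x y + off M x y * off M' y x"
    using row[of "[x, y]"] by (cases "x = y") (simp_all add: dg_def off_def)
  show "off (mat_mul N 2 M M') x y = dg M x y * off M' x y + off M x y * dg M' y x" if "x \<noteq> y"
    using row[of "[y, x]"] that by (simp add: dg_def off_def)
qed

lemma mul_eq_idI:
  assumes "M \<in> match_hom N 2 2" "M' \<in> match_hom N 2 2"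
    and "\<And>x y. x \<in> {1..N} \<Longrightarrow> y \<in> {1..N} \<Longrightarrow> dg M x y * dg M' x y + off M x y * off M' y x = 1"
    and "\<And>x y. x \<in> {1..N} \<Longrightarrow> y \<in> {1..N} \<Longrightarrow> x \<noteq> y \<Longrightarrow>
      dg M x y * off M' x y + off M x y * dg M' y x = 0"
  shows "mat_mul N 2 M M' = mat_id N 2"
proof (rule match_hom_2_eqI[OF mat_mul_in_hom[OF assms(1,2)] mat_id_in_hom])
  fix x y
  assume xy: "x \<in> {1..N}" "y \<in> {1..N}"
  show "dg (mat_mul N 2 M M') x y = dg (mat_id N 2) x y \<and> off (mat_mul N 2 M M') x y = off (mat_id N 2) x y"
    using assms(3,4)[OF xy] coeffs_id[OF xy] coeffs_mul[OF assms(1,2) xy] by (cases "x = y") simp_all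
qed

definition coeff_mat :: "nat \<Rightarrow> (nat \<Rightarrow> nat \<Rightarrow> complex) \<Rightarrow> (nat \<Rightarrow> nat \<Rightarrow> complex) \<Rightarrow> cmat" where
  "coeff_mat N d c = (\<lambda>u v. if u \<in> words N 2 \<and> v \<in> words N 2 then
     (if v = u then d (u ! 0) (u ! 1) else if v = rev u then c (u ! 0) (u ! 1) else 0) else 0)"

lemma coeff_mat_in_hom: "coeff_mat N d c \<in> match_hom N 2 2"
  by (auto simp: coeff_mat_def match_hom_def split: if_splits)

lemma coeffs_coeff_mat:
  assumes "x \<in> {1..N}" "y \<in> {1..N}"
  shows "dg (coeff_mat N d c) x y = d x y" "x \<noteq> y \<Longrightarrow> off (coeff_mat N d c) x y = c x y"
  using assms by (simp_all add: dg_def off_def coeff_mat_def)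

definition det2 :: "cmat \<Rightarrow> nat \<Rightarrow> nat \<Rightarrow> complex" where
  "det2 M x y = dg M x y * dg M y x - off M x y * off M y x"

text \<open>Each block is inverted by its adjugate. For \<open>x = y\<close> the quantity
  \<open>det2\<close> is the square of the single entry, so the same formula gives its
  reciprocal.\<close>

lemma inverse_exists:
  assumes M: "M \<in> match_hom N 2 2"
    and det: "\<And>x y. x \<in> {1..N} \<Longrightarrow> y \<in> {1..N} \<Longrightarrow> det2 M x y \<noteq> 0"
  shows "\<exists>M'\<in>match_hom N 2 2. mat_mul N 2 M M' = mat_id N 2 \<and> mat_mul N 2 M' M = mat_id N 2"
proof -
  define M' where "M' = coeff_mat N (\<lambda>x y. dg M y x / det2 M x y) (\<lambda>x y. - off M x y / det2 M x y)"
  have M': "M' \<in> match_hom N 2 2"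
    by (simp add: M'_def coeff_mat_in_hom)
  have sym: "det2 M y x = det2 M x y" for x y
    by (simp add: det2_def algebra_simps)
  have d: "dg M' x y = dg M y x / det2 M x y" and c: "off M' x y = - off M x y / det2 M x y"
    if "x \<in> {1..N}" "y \<in> {1..N}" for x y
    using coeffs_coeff_mat[OF that] by (cases "x = y"; simp add: M'_def)+
  have "mat_mul N 2 M M' = mat_id N 2"
  proof (rule mul_eq_idI[OF M M'])
    fix x y
    assume xy: "x \<in> {1..N}" "y \<in> {1..N}"
    show "dg M x y * dg M' x y + off M x y * off M' y x = 1"
      using det[OF xy] by (simp add: d[OF xy] c[OF xy] c[OF xy(2,1)] sym[of x y] divide_simps) (simp add: det2_def)
    show "dg M x y * off M' x y + off M x y * dg M' y x = 0"
      using det[OF xy] by (simp add: d[OF xy] d[OF xy(2,1)] c[OF xy] sym[of x y])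
  qed
  moreover have "mat_mul N 2 M' M = mat_id N 2"
  proof (rule mul_eq_idI[OF M' M])
    fix x y
    assume xy: "x \<in> {1..N}" "y \<in> {1..N}"
    show "dg M' x y * dg M x y + off M' x y * off M y x = 1"
      using det[OF xy] by (simp add: d[OF xy] c[OF xy] c[OF xy(2,1)] sym[of x y] divide_simps) (simp add: det2_def)
    show "dg M' x y * off M x y + off M' x y * dg M y x = 0"
      using det[OF xy] by (simp add: d[OF xy] d[OF xy(2,1)] c[OF xy] sym[of x y])
  qed
  ultimately show ?thesis
    using M' by blast
qed

lemma det2_nonzero:
  assumes "M \<in> match_hom N 2 2" "M' \<in> match_hom N 2 2" "mat_mul N 2 M M' = mat_id N 2"
    and "x \<in> {1..N}" "y \<in> {1..N}"
  shows "det2 M x y \<noteq> 0"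
proof (cases "x = y")
  case True
  then show ?thesis
    using coeffs_mul(1)[OF assms(1,2,4,5)] coeffs_id(1)[OF assms(4,5)] by (auto simp: assms(3) det2_def)
next
  case False
  have "dg M x y * dg M' x y + off M x y * off M' y x = 1"
    "dg M y x * dg M' y x + off M y x * off M' x y = 1"
    "dg M x y * off M' x y + off M x y * dg M' y x = 0"
    "dg M y x * off M' y x + off M y x * dg M' x y = 0"
    using coeffs_mul[OF assms(1,2,4,5)] coeffs_mul[OF assms(1,2,5,4)] False False[symmetric]
    by (simp_all add: assms(3) coeffs_id[OF assms(4,5)] coeffs_id[OF assms(5,4)])
  \<comment> \<open>Multiplicativity of the determinant for the block on \<open>xy\<close> and
    \<open>yx\<close>.\<close>
  then have "det2 M x y * det2 M' x y = 1"
    unfolding det2_def by algebra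
  then show ?thesis
    by auto
qed


section \<open>Conjugation by diagonal matrices\<close>

definition conj_mat :: "(nat list \<Rightarrow> complex) \<Rightarrow> cmat \<Rightarrow> cmat" where
  "conj_mat h M = (\<lambda>u v. h u * M u v / h v)"

text \<open>The weight \<open>h\<close> multiplied over the three pairs of positions, each read from
  left to right.\<close>

definition gauge3 :: "(nat list \<Rightarrow> complex) \<Rightarrow> nat list \<Rightarrow> complex" where
  "gauge3 h w = h [w ! 0, w ! 1] * h [w ! 0, w ! 2] * h [w ! 1, w ! 2]"

lemma conj_mat_in_hom: "M \<in> match_hom N m n \<Longrightarrow> conj_mat h M \<in> match_hom N m n"
  by (auto simp: conj_mat_def match_hom_def)

lemma conj_mat_id:
  assumes "\<And>w. w \<in> words N n \<Longrightarrow> h w \<noteq> 0"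
  shows "conj_mat h (mat_id N n) = mat_id N n"
  using assms by (auto simp: conj_mat_def mat_id_def fun_eq_iff)

lemma mat_mul_conj:
  assumes "\<And>w. w \<in> words N m \<Longrightarrow> h w \<noteq> 0"
  shows "mat_mul N m (conj_mat h M) (conj_mat h M') = conj_mat h (mat_mul N m M M')"
proof (intro ext)
  fix u v
  have "mat_mul N m (conj_mat h M) (conj_mat h M') u v
      = (\<Sum>w\<in>words N m. h u * (M u w * M' w v) / h v)"
    unfolding mat_mul_def conj_mat_def by (intro sum.cong) (auto simp: assms)
  then show "mat_mul N m (conj_mat h M) (conj_mat h M') u v = conj_mat h (mat_mul N m M M') u v"
    by (simp add: conj_mat_def mat_mul_def sum_distrib_left sum_divide_distrib)
qed

text \<open>When two neighbours trade places the other two factors of \<open>gauge3\<close> are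
  merely permuted and cancel, leaving the ratio of \<open>h\<close> at the exchanged pair.\<close>

lemma conj_on:
  assumes M: "M \<in> match_hom N 2 2" and h: "\<And>w. w \<in> words N 2 \<Longrightarrow> h w \<noteq> 0"
  shows "on1 N (conj_mat h M) = conj_mat (gauge3 h) (on1 N M)"
    and "on2 N (conj_mat h M) = conj_mat (gauge3 h) (on2 N M)"
proof -
  have conj: "conj_mat h M \<in> match_hom N 2 2"
    by (rule conj_mat_in_hom[OF M])
  have h': "h [a, b] \<noteq> 0" if "a \<in> {1..N}" "b \<in> {1..N}" for a b
    using h that by (simp add: words_def)
  have zero: "L u w = L' u w" if "L \<in> match_hom N 3 3" "L' \<in> match_hom N 3 3"
      "u \<notin> words N 3 \<or> w \<notin> words N 3" for L L' u w
    using hom_zeroI[OF that(1)] hom_zeroI[OF that(2)] that(3) by simp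
  show "on1 N (conj_mat h M) = conj_mat (gauge3 h) (on1 N M)"
  proof (intro ext)
    fix u w
    show "on1 N (conj_mat h M) u w = conj_mat (gauge3 h) (on1 N M) u w"
    proof (cases "u \<in> words N 3 \<and> w \<in> words N 3")
      case True
      then obtain x y z x' y' z' where
        u: "u = [x, y, z]" "x \<in> {1..N}" "y \<in> {1..N}" "z \<in> {1..N}" and
        w: "w = [x', y', z']" "x' \<in> {1..N}" "y' \<in> {1..N}" "z' \<in> {1..N}"
        by (auto simp: words_3)
      note nz = h'[OF u(2,3)] h'[OF u(3,2)] h'[OF u(2,4)] h'[OF u(3,4)]
      \<comment> \<open>Either nothing moves, or the first two letters are exchanged, or the entry
        is zero on both sides.\<close>
      consider "z' = z" "x' = x" "y' = y" | "z' = z" "x' = y" "y' = x" "x \<noteq> y"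
        | "z' \<noteq> z \<or> [x', y'] \<noteq> [x, y] \<and> [x', y'] \<noteq> [y, x]"
        by auto
      then show ?thesis
      proof cases
        case 1
        then show ?thesis
          using nz u w by (simp add: on1_def on2_def mat_tens_def conj_mat_def mat_id_def gauge3_def)
      next
        case 2
        then show ?thesis
          using nz u w by (simp add: on1_def on2_def mat_tens_def conj_mat_def mat_id_def gauge3_def field_simps)
      next
        case 3
        then show ?thesis
          unfolding u(1) w(1) by (auto simp: on1_def on2_def mat_tens_def conj_mat_def mat_id_def row_2[OF M])
      qed
    next
      case False
      then show ?thesis
        using zero[OF on_in_hom(1)[OF conj] conj_mat_in_hom[OF on_in_hom(1)[OF M]]] by simp
    qed
  qed
  show "on2 N (conj_mat h M) = conj_mat (gauge3 h) (on2 N M)"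
  proof (intro ext)
    fix u w
    show "on2 N (conj_mat h M) u w = conj_mat (gauge3 h) (on2 N M) u w"
    proof (cases "u \<in> words N 3 \<and> w \<in> words N 3")
      case True
      then obtain x y z x' y' z' where
        u: "u = [x, y, z]" "x \<in> {1..N}" "y \<in> {1..N}" "z \<in> {1..N}" and
        w: "w = [x', y', z']" "x' \<in> {1..N}" "y' \<in> {1..N}" "z' \<in> {1..N}"
        by (auto simp: words_3)
      note nz = h'[OF u(2,3)] h'[OF u(4,3)] h'[OF u(2,4)] h'[OF u(3,4)]
      consider "x' = x" "y' = y" "z' = z" | "x' = x" "y' = z" "z' = y" "y \<noteq> z"
        | "x' \<noteq> x \<or> [y', z'] \<noteq> [y, z] \<and> [y', z'] \<noteq> [z, y]"
        by auto
      then show ?thesis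
      proof cases
        case 1
        then show ?thesis
          using nz u w by (simp add: on1_def on2_def mat_tens_def conj_mat_def mat_id_def gauge3_def)
      next
        case 2
        then show ?thesis
          using nz u w by (simp add: on1_def on2_def mat_tens_def conj_mat_def mat_id_def gauge3_def field_simps)
      next
        case 3
        then show ?thesis
          unfolding u(1) w(1) by (auto simp: on1_def on2_def mat_tens_def conj_mat_def mat_id_def row_2[OF M])
      qed
    next
      case False
      then show ?thesis
        using zero[OF on_in_hom(2)[OF conj] conj_mat_in_hom[OF on_in_hom(2)[OF M]]] by simp
    qed
  qed
qed

lemma gauge3_nonzero:
  assumes "\<And>w. w \<in> words N 2 \<Longrightarrow> h w \<noteq> 0" "w \<in> words N 3"
  shows "gauge3 h w \<noteq> 0"
  using assms by (auto simp: gauge3_def words_3 words_2)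

text \<open>All six factors receive the same three-letter gauge, which telescopes in the
  products.\<close>

lemma cubic_rel_conj:
  assumes "cubic_rel N A B C A' B' C'"
    and hom: "A \<in> match_hom N 2 2" "B \<in> match_hom N 2 2" "C \<in> match_hom N 2 2"
      "A' \<in> match_hom N 2 2" "B' \<in> match_hom N 2 2" "C' \<in> match_hom N 2 2"
    and h: "\<And>w. w \<in> words N 2 \<Longrightarrow> h w \<noteq> 0"
  shows "cubic_rel N (conj_mat h A) (conj_mat h B) (conj_mat h C)
    (conj_mat h A') (conj_mat h B') (conj_mat h C')"
  using assms(1) unfolding cubic_rel_def mul3_def
  by (simp add: conj_on[OF hom(1) h] conj_on[OF hom(2) h] conj_on[OF hom(3) h] conj_on[OF hom(4) h]
      conj_on[OF hom(5) h] conj_on[OF hom(6) h] mat_mul_conj[OF gauge3_nonzero[OF h]])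

lemma loop_pair_conj:
  assumes "loop_pair N S R" and h: "\<And>w. w \<in> words N 2 \<Longrightarrow> h w \<noteq> 0"
  shows "loop_pair N (conj_mat h S) (conj_mat h R)"
proof -
  from assms(1) obtain R' where R': "R' \<in> match_hom N 2 2"
      "mat_mul N 2 R R' = mat_id N 2" "mat_mul N 2 R' R = mat_id N 2"
    by (auto simp: loop_pair_def)
  have "mat_mul N 2 (conj_mat h R) (conj_mat h R') = mat_id N 2"
      "mat_mul N 2 (conj_mat h R') (conj_mat h R) = mat_id N 2"
    using R' by (simp_all add: mat_mul_conj[OF h] conj_mat_id[OF h])
  then have "\<exists>R'\<in>match_hom N 2 2. mat_mul N 2 (conj_mat h R) R' = mat_id N 2 \<and>
      mat_mul N 2 R' (conj_mat h R) = mat_id N 2"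
    using conj_mat_in_hom[OF R'(1)] by blast
  then show ?thesis
    using assms(1)
    by (auto simp: loop_pair_def mat_mul_conj[OF h] conj_mat_id[OF h] intro: conj_mat_in_hom cubic_rel_conj[OF _ _ _ _ _ _ _ h])
qed


section \<open>The recipe gives functors\<close>

text \<open>Coefficients that depend only on the nation \<open>nu x\<close> and the county of the letters (\<open>tp x\<close> says
  that the letter \<open>x\<close> lives in the top county) satisfy the six equations formally, also for equal
  letters.\<close>

lemma cubic_eqs_by_class:
  fixes nu :: "nat \<Rightarrow> 'k" and al be ep :: "'k \<Rightarrow> complex"
  assumes ep: "\<And>k. ep k * ep k = 1"
    and dS: "\<And>x y. x \<in> L \<Longrightarrow> y \<in> L \<Longrightarrow> dg S x y =
      (if nu x \<noteq> nu y \<or> tp x \<noteq> tp y then 0 else if tp x then ep (nu x) else - ep (nu x))"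
    and cS: "\<And>x y. x \<in> L \<Longrightarrow> y \<in> L \<Longrightarrow> off S x y = (if nu x \<noteq> nu y \<or> tp x \<noteq> tp y then 1 else 0)"
    and dR: "\<And>x y. x \<in> L \<Longrightarrow> y \<in> L \<Longrightarrow> dg R x y =
      (if nu x \<noteq> nu y then 0
       else if tp x then if tp y then al (nu x) else 0
       else if tp y then al (nu x) + be (nu x) else be (nu x))"
    and cR: "\<And>x y. x \<in> L \<Longrightarrow> y \<in> L \<Longrightarrow> off R x y =
      (if nu x \<noteq> nu y then U (nu x) (nu y)
       else if tp x = tp y then 0
       else if tp y then ep (nu x) * al (nu x) else - ep (nu x) * be (nu x))"
    and L: "x \<in> L" "y \<in> L" "z \<in> L"
  shows "cubic_eqs S S S S S S x y z" "cubic_eqs R R R R R R x y z"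
    "cubic_eqs R R S S R R x y z" "cubic_eqs R S S S S R x y z"
proof -
  have ep': "ep k * (ep k * c) = c" for k c
    by (metis ep mult.assoc mult_1)
  note coeffs = dS[OF L(1,2)] dS[OF L(2,1)] dS[OF L(1,3)] dS[OF L(3,1)] dS[OF L(2,3)] dS[OF L(3,2)]
    cS[OF L(1,2)] cS[OF L(2,1)] cS[OF L(1,3)] cS[OF L(3,1)] cS[OF L(2,3)] cS[OF L(3,2)]
    dR[OF L(1,2)] dR[OF L(2,1)] dR[OF L(1,3)] dR[OF L(3,1)] dR[OF L(2,3)] dR[OF L(3,2)]
    cR[OF L(1,2)] cR[OF L(2,1)] cR[OF L(1,3)] cR[OF L(3,1)] cR[OF L(2,3)] cR[OF L(3,2)]
  \<comment> \<open>The five set partitions of three letters into nations, each refined by the eight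
    choices of counties; what remains are polynomial identities modulo
    \<open>ep k * ep k = 1\<close>.\<close>
  consider "nu y = nu x" "nu z = nu x" | "nu y = nu x" "nu z \<noteq> nu x" | "nu z = nu x" "nu y \<noteq> nu x"
    | "nu z = nu y" "nu x \<noteq> nu y" | "nu y \<noteq> nu x" "nu z \<noteq> nu x" "nu z \<noteq> nu y"
    by metis
  then have "cubic_eqs S S S S S S x y z \<and> cubic_eqs R R R R R R x y z \<and>
    cubic_eqs R R S S R R x y z \<and> cubic_eqs R S S S S R x y z"
    unfolding cubic_eqs_def coeffs
    by cases (cases "tp x"; cases "tp y"; cases "tp z"; simp add: algebra_simps ep ep')+
  then show "cubic_eqs S S S S S S x y z" "cubic_eqs R R R R R R x y z"
    "cubic_eqs R R S S R R x y z" "cubic_eqs R S S S S R x y z"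
    by blast+
qed

section \<open>Nations, their total order and their positions\<close>

lemma index_setD:
  assumes "\<Lambda> \<in> index_set N"
  shows "finite \<Lambda>" and "n \<in> \<Lambda> \<Longrightarrow> residents n \<subseteq> {1..N}" and "n \<in> \<Lambda> \<Longrightarrow> finite (residents n)"
    and "n \<in> \<Lambda> \<Longrightarrow> residents n \<noteq> {}" and "x \<in> {1..N} \<Longrightarrow> \<exists>n\<in>\<Lambda>. x \<in> residents n"
    and "n \<in> \<Lambda> \<Longrightarrow> n' \<in> \<Lambda> \<Longrightarrow> n \<noteq> n' \<Longrightarrow> residents n \<inter> residents n' = {}"
    and "n \<in> \<Lambda> \<Longrightarrow> sign n = 1 \<or> sign n = - 1"
    and "n \<in> \<Lambda> \<Longrightarrow> top_county n \<inter> bottom_county n = {}" and "n \<in> \<Lambda> \<Longrightarrow> top_county n \<noteq> {}"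
proof -
  have part: "partition_on {1..N} (residents ` \<Lambda>)" and inj: "inj_on residents \<Lambda>"
    and nation: "\<forall>n\<in>\<Lambda>. top_county n \<inter> bottom_county n = {} \<and> top_county n \<noteq> {} \<and> sign n \<in> {1, - 1}"
    using assms by (auto simp: index_set_def)
  show "finite \<Lambda>"
    using finite_elements[OF _ part] inj by (simp add: finite_image_iff)
  show sub: "residents n \<subseteq> {1..N}" if "n \<in> \<Lambda>" for n
    using partition_onD1[OF part] that by auto
  show "finite (residents n)" if "n \<in> \<Lambda>"
    using finite_subset[OF sub[OF that]] by simp
  show "residents n \<noteq> {}" if "n \<in> \<Lambda>"
    using partition_onD3[OF part] that by auto
  show "\<exists>n\<in>\<Lambda>. x \<in> residents n" if "x \<in> {1..N}"
    using partition_onD1[OF part] that by auto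
  show "residents n \<inter> residents n' = {}" if "n \<in> \<Lambda>" "n' \<in> \<Lambda>" "n \<noteq> n'"
  proof -
    have "residents n \<noteq> residents n'"
      using inj_onD[OF inj _ that(1,2)] that(3) by auto
    then show ?thesis
      using disjointD[OF partition_onD2[OF part]] that by auto
  qed
  show "n \<in> \<Lambda> \<Longrightarrow> sign n = 1 \<or> sign n = - 1"
    "n \<in> \<Lambda> \<Longrightarrow> top_county n \<inter> bottom_county n = {}" "n \<in> \<Lambda> \<Longrightarrow> top_county n \<noteq> {}"
    using nation by auto
qed

lemma nation_of_eq:
  assumes "\<Lambda> \<in> index_set N" "n \<in> \<Lambda>" "x \<in> residents n"
  shows "nation_of \<Lambda> x = n"
  unfolding nation_of_def
  using assms index_setD(6)[OF assms(1)] by (intro the_equality) blast+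

lemma nation_of_in:
  assumes "\<Lambda> \<in> index_set N" "x \<in> {1..N}"
  shows "nation_of \<Lambda> x \<in> \<Lambda>" "x \<in> residents (nation_of \<Lambda> x)"
  using index_setD(5)[OF assms] nation_of_eq[OF assms(1)] by auto

lemma bottom_iff_not_top:
  assumes "\<Lambda> \<in> index_set N" "x \<in> {1..N}"
  shows "x \<in> bottom_county (nation_of \<Lambda> x) \<longleftrightarrow> x \<notin> top_county (nation_of \<Lambda> x)"
  using nation_of_in[OF assms] index_setD(8)[OF assms(1)] by (auto simp: residents_def)

lemma precedes_irrefl: "\<not> precedes n n"
  by (simp add: precedes_def)

lemma precedes_trans: "precedes n n' \<Longrightarrow> precedes n' n'' \<Longrightarrow> precedes n n''"
  unfolding precedes_def by linarith

text \<open>The last tie-break always decides, since disjoint nonempty nations have different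
  smallest residents.\<close>

lemma precedes_total:
  assumes "\<Lambda> \<in> index_set N" "n \<in> \<Lambda>" "n' \<in> \<Lambda>" "n \<noteq> n'"
  shows "precedes n n' \<or> precedes n' n"
proof -
  have "Min (residents n) \<in> residents n" "Min (residents n') \<in> residents n'"
    using assms index_setD(3,4)[OF assms(1)] by (auto intro: Min_in)
  then have "Min (residents n) \<noteq> Min (residents n')"
    using index_setD(6)[OF assms] by auto
  then show ?thesis
    unfolding precedes_def by linarith
qed

lemma rank_less:
  assumes "finite \<Lambda>" "n \<in> \<Lambda>" "precedes n n'"
  shows "rank \<Lambda> n < rank \<Lambda> n'"
proof -
  have "{m \<in> \<Lambda>. precedes m n} \<subset> {m \<in> \<Lambda>. precedes m n'}"
    using assms(2,3) precedes_irrefl precedes_trans by blast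
  then have "card {m \<in> \<Lambda>. precedes m n} < card {m \<in> \<Lambda>. precedes m n'}"
    using assms(1) by (intro psubset_card_mono) auto
  then show ?thesis
    by (simp add: rank_def)
qed

lemma rank_eq_iff:
  assumes "\<Lambda> \<in> index_set N" "n \<in> \<Lambda>" "n' \<in> \<Lambda>"
  shows "rank \<Lambda> n = rank \<Lambda> n' \<longleftrightarrow> n = n'"
  using precedes_total[OF assms] rank_less index_setD(1)[OF assms(1)] assms(2,3) by (metis less_irrefl)

lemma rank_bounds:
  assumes "\<Lambda> \<in> index_set N" "n \<in> \<Lambda>"
  shows "1 \<le> rank \<Lambda> n" "rank \<Lambda> n \<le> card \<Lambda>"
proof -
  have "card {m \<in> \<Lambda>. precedes m n} < card \<Lambda>"
    using assms precedes_irrefl index_setD(1)[OF assms(1)] by (intro psubset_card_mono) auto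
  then show "1 \<le> rank \<Lambda> n" "rank \<Lambda> n \<le> card \<Lambda>"
    by (simp_all add: rank_def)
qed

lemma coeffs_decode:
  assumes "x \<in> {1..N}" "y \<in> {1..N}"
  shows "dg (decode N a A) x y
      = (if x = y then a x else if x < y then snd (snd (A x y)) else fst (fst (A y x)))"
    and "off (decode N a A) x y
      = (if x = y then 0 else if x < y then fst (snd (A x y)) else snd (fst (A y x)))"
  using decode_scalar[OF assms(1), of a A] decode_block[OF assms, of a A] decode_block[OF assms(2,1), of a A]
  by (cases x y rule: linorder_cases; simp add: dg_def off_def prod_eq_iff)+

definition is_top :: "nation set \<Rightarrow> nat \<Rightarrow> bool" where
  "is_top \<Lambda> x \<longleftrightarrow> x \<in> top_county (nation_of \<Lambda> x)"

text \<open>Since \<open>C\<close> is inverted when its indices are exchanged, both entries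
  \<open>\<mu> C\<close> and \<open>\<mu> / C\<close> of the recipe are values of this one function
  of an ordered pair of nations.\<close>

definition cross :: "nation set \<Rightarrow> params \<Rightarrow> nation \<Rightarrow> nation \<Rightarrow> complex" where
  "cross \<Lambda> x n n' = mu x (rank \<Lambda> n) (rank \<Lambda> n') * C_par x (rank \<Lambda> n) (rank \<Lambda> n')"

text \<open>The recipe freed from the condition \<open>i < j\<close>: only nation and county of the
  two letters matter. This form feeds the cubic equations, the classification and the relabelling
  alike.\<close>

lemma recipe_coeffs:
  fixes x :: params and \<Lambda> :: "nation set" and N :: nat
  defines "S \<equiv> fst (recipe N (\<Lambda>, x))" and "R \<equiv> snd (recipe N (\<Lambda>, x))"
  assumes \<Lambda>: "\<Lambda> \<in> index_set N" and i: "i \<in> {1..N}" and j: "j \<in> {1..N}"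
  defines "n \<equiv> nation_of \<Lambda> i" and "n' \<equiv> nation_of \<Lambda> j"
  defines "\<alpha> \<equiv> par_alpha x (rank \<Lambda> n)" and "\<beta> \<equiv> par_beta x (rank \<Lambda> n)"
    and "\<epsilon> \<equiv> complex_of_int (sign n)"
  shows "dg S i j = (if n \<noteq> n' \<or> is_top \<Lambda> i \<noteq> is_top \<Lambda> j then 0 else if is_top \<Lambda> i then \<epsilon> else - \<epsilon>)"
    and "off S i j = (if n \<noteq> n' \<or> is_top \<Lambda> i \<noteq> is_top \<Lambda> j then 1 else 0)"
    and "dg R i j = (if n \<noteq> n' then 0 else if is_top \<Lambda> i then if is_top \<Lambda> j then \<alpha> else 0
      else if is_top \<Lambda> j then \<alpha> + \<beta> else \<beta>)"
    and "off R i j = (if n \<noteq> n' then cross \<Lambda> x n n' else if is_top \<Lambda> i = is_top \<Lambda> j then 0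
      else if is_top \<Lambda> j then \<epsilon> * \<alpha> else - \<epsilon> * \<beta>)"
proof -
  have S: "S = decode N (recipe_b \<Lambda>) (recipe_B \<Lambda>)" and R: "R = decode N (recipe_a \<Lambda> x) (recipe_A \<Lambda> x)"
    by (simp_all add: S_def R_def recipe_def)
  have ij: "n = n' \<and> is_top \<Lambda> i = is_top \<Lambda> j" if "i = j"
    using that by (simp add: n_def n'_def)
  note bot = bottom_iff_not_top[OF \<Lambda> i] bottom_iff_not_top[OF \<Lambda> j]
  show "dg S i j = (if n \<noteq> n' \<or> is_top \<Lambda> i \<noteq> is_top \<Lambda> j then 0 else if is_top \<Lambda> i then \<epsilon> else - \<epsilon>)"
    "off S i j = (if n \<noteq> n' \<or> is_top \<Lambda> i \<noteq> is_top \<Lambda> j then 1 else 0)"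
    using ij bot unfolding S coeffs_decode[OF i j] is_top_def \<epsilon>_def n_def n'_def
    by (auto simp: recipe_B_def recipe_b_def Let_def flip_block_def scalar_block_def)
  show "dg R i j = (if n \<noteq> n' then 0 else if is_top \<Lambda> i then if is_top \<Lambda> j then \<alpha> else 0
      else if is_top \<Lambda> j then \<alpha> + \<beta> else \<beta>)"
    using ij bot unfolding R coeffs_decode[OF i j] is_top_def \<alpha>_def \<beta>_def n_def n'_def
    by (auto simp: recipe_A_def recipe_a_def Let_def scalar_block_def)
  have cross: "mu x (rank \<Lambda> n') (rank \<Lambda> n) / C_par x (rank \<Lambda> n') (rank \<Lambda> n) = cross \<Lambda> x n n'"
    if "n \<noteq> n'"
  proof -
    have "rank \<Lambda> n \<noteq> rank \<Lambda> n'"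
      using rank_eq_iff[OF \<Lambda>] nation_of_in(1)[OF \<Lambda>] i j that by (auto simp: n_def n'_def)
    then show ?thesis
      by (auto simp: cross_def mu_def C_par_def)
  qed
  show "off R i j = (if n \<noteq> n' then cross \<Lambda> x n n' else if is_top \<Lambda> i = is_top \<Lambda> j then 0
      else if is_top \<Lambda> j then \<epsilon> * \<alpha> else - \<epsilon> * \<beta>)"
  proof (cases "n = n'")
    case True
    then show ?thesis
      using ij bot unfolding R coeffs_decode[OF i j] is_top_def \<alpha>_def \<beta>_def \<epsilon>_def n_def n'_def
      by (auto simp: recipe_A_def recipe_a_def Let_def scalar_block_def)
  next
    case False
    then show ?thesis
      using ij cross unfolding R coeffs_decode[OF i j] n_def n'_def
      by (auto simp: recipe_A_def Let_def cross_def)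
  qed
qed

lemma recipe_in_hom: "fst (recipe N p) \<in> match_hom N 2 2" "snd (recipe N p) \<in> match_hom N 2 2"
  by (simp_all add: recipe_def decode_in_match_hom split: prod.split)

lemma cross_nonzero:
  assumes "(\<Lambda>, x) \<in> param_index_set N" "n \<in> \<Lambda>" "n' \<in> \<Lambda>" "n \<noteq> n'"
  shows "cross \<Lambda> x n n' \<noteq> 0"
proof -
  have \<Lambda>: "\<Lambda> \<in> index_set N" and x: "x \<in> param_space \<Lambda>"
    using assms(1) by (auto simp: param_index_set_def)
  have "rank \<Lambda> n \<noteq> rank \<Lambda> n'"
    using rank_eq_iff[OF \<Lambda> assms(2,3)] assms(4) by simp
  moreover have "par_mu x s t \<noteq> 0" "par_C x s t \<noteq> 0" if "1 \<le> s" "s < t" "t \<le> card \<Lambda>" for s t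
    using x that by (auto simp: param_space_def)
  ultimately show ?thesis
    using rank_bounds[OF \<Lambda> assms(2)] rank_bounds[OF \<Lambda> assms(3)]
    by (cases "rank \<Lambda> n" "rank \<Lambda> n'" rule: linorder_cases) (simp_all add: cross_def mu_def C_par_def)
qed

lemma loop_pair_recipe:
  assumes p: "p \<in> param_index_set N"
  shows "loop_pair N (fst (recipe N p)) (snd (recipe N p))"
proof -
  obtain \<Lambda> x where p_eq: "p = (\<Lambda>, x)" and \<Lambda>: "\<Lambda> \<in> index_set N" and x: "x \<in> param_space \<Lambda>"
    using p by (auto simp: param_index_set_def)
  define S R where "S = fst (recipe N (\<Lambda>, x))" and "R = snd (recipe N (\<Lambda>, x))"
  have S: "S \<in> match_hom N 2 2" and R: "R \<in> match_hom N 2 2"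
    by (simp_all add: S_def R_def recipe_in_hom)
  \<comment> \<open>The default \<open>1\<close> makes the square equal to one for every nation, as
    \<open>cubic_eqs_by_class\<close> demands, and not only for those of the index.\<close>
  define ep where "ep n = (if n \<in> \<Lambda> then complex_of_int (sign n) else 1)" for n
  have ep: "ep n * ep n = 1" for n
    using index_setD(7)[OF \<Lambda>, of n] by (auto simp: ep_def)
  have ep_nation: "complex_of_int (sign (nation_of \<Lambda> i)) = ep (nation_of \<Lambda> i)" if "i \<in> {1..N}" for i
    using nation_of_in(1)[OF \<Lambda> that] by (simp add: ep_def)
  note coeffs = recipe_coeffs[OF \<Lambda>, of _ _ x, folded S_def R_def]
  note eqs = cubic_eqs_by_class[where nu = "nation_of \<Lambda>" and tp = "is_top \<Lambda>" and ep = ep and S = S and R = R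
      and al = "\<lambda>n. par_alpha x (rank \<Lambda> n)" and be = "\<lambda>n. par_beta x (rank \<Lambda> n)" and L = "{1..N}"
      and U = "cross \<Lambda> x"]
  have eqs: "cubic_eqs S S S S S S i j k" "cubic_eqs R R R R R R i j k"
    "cubic_eqs R R S S R R i j k" "cubic_eqs R S S S S R i j k"
    if "i \<in> {1..N}" "j \<in> {1..N}" "k \<in> {1..N}" for i j k
    by (rule eqs[OF ep]; simp only: coeffs ep_nation that)+
  have cubic: "cubic_rel N S S S S S S" "cubic_rel N R R R R R R" "cubic_rel N R R S S R R" "cubic_rel N R S S S S R"
    by (rule cubic_relI; simp add: S R eqs)+
  have "mat_mul N 2 S S = mat_id N 2"
  proof (rule mul_eq_idI[OF S S])
    fix i j
    assume ij: "i \<in> {1..N}" "j \<in> {1..N}"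
    show "dg S i j * dg S i j + off S i j * off S j i = 1" "dg S i j * off S i j + off S i j * dg S j i = 0"
      using ep by (auto simp: coeffs(1,2)[OF ij] coeffs(1,2)[OF ij(2,1)] ep_nation[OF ij(1)] ep_nation[OF ij(2)])
  qed
  moreover have "\<exists>R'\<in>match_hom N 2 2. mat_mul N 2 R R' = mat_id N 2 \<and> mat_mul N 2 R' R = mat_id N 2"
  proof (rule inverse_exists[OF R])
    fix i j
    assume ij: "i \<in> {1..N}" "j \<in> {1..N}"
    let ?n = "nation_of \<Lambda> i" and ?n' = "nation_of \<Lambda> j"
    note in_\<Lambda> = nation_of_in(1)[OF \<Lambda> ij(1)] nation_of_in(1)[OF \<Lambda> ij(2)]
    \<comment> \<open>The determinant is minus a product of two cross entries between nations,
      \<open>\<alpha>\<close> or \<open>\<beta>\<close> squared within a county, and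
      \<open>\<epsilon>\<close> squared times \<open>\<alpha> * \<beta>\<close> for a mixed
      block.\<close>
    show "det2 R i j \<noteq> 0"
    proof (cases "?n = ?n'")
      case False
      then show ?thesis
        using cross_nonzero[OF p[unfolded p_eq]] in_\<Lambda>
        by (simp add: det2_def coeffs(3,4)[OF ij] coeffs(3,4)[OF ij(2,1)])
    next
      case True
      have "par_alpha x (rank \<Lambda> ?n) \<noteq> 0"
        using x in_\<Lambda> by (simp add: param_space_def)
      moreover have "par_beta x (rank \<Lambda> ?n) \<noteq> 0" if "\<not> is_top \<Lambda> i \<or> \<not> is_top \<Lambda> j"
      proof -
        have "bottom_county ?n \<noteq> {}"
          using bottom_iff_not_top[OF \<Lambda> ij(1)] bottom_iff_not_top[OF \<Lambda> ij(2)] that True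
          by (auto simp: is_top_def)
        then show ?thesis
          using x in_\<Lambda> by (simp add: param_space_def)
      qed
      moreover have "sign ?n \<noteq> 0"
        using index_setD(7)[OF \<Lambda> in_\<Lambda>(1)] by auto
      ultimately show ?thesis
        using True by (auto simp: det2_def coeffs(3,4)[OF ij] coeffs(3,4)[OF ij(2,1)])
    qed
  qed
  ultimately show ?thesis
    using S R cubic by (simp add: p_eq loop_pair_def flip: S_def R_def)
qed


section \<open>Normalisation by diagonal conjugation\<close>

lemma coeffs_conj:
  assumes "\<And>w. w \<in> words N 2 \<Longrightarrow> h w \<noteq> 0" "x \<in> {1..N}" "y \<in> {1..N}"
  shows "dg (conj_mat h M) x y = dg M x y"
    and "off (conj_mat h M) x y = h [x, y] * off M x y / h [y, x]"
  using assms by (simp_all add: dg_def off_def conj_mat_def)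

lemma swap_square:
  assumes "loop_pair N S R" "x \<in> {1..N}"
  shows "dg S x x * dg S x x = 1"
proof -
  have S: "S \<in> match_hom N 2 2" "mat_mul N 2 S S = mat_id N 2"
    using assms(1) by (auto simp: loop_pair_def)
  show ?thesis
    using coeffs_mul(1)[OF S(1,1) assms(2,2)] coeffs_id(1)[OF assms(2,2)] by (simp add: S(2))
qed

text \<open>An involution with a nonzero off-diagonal entry has trace zero in the block, and the
  braid relation makes the product of its diagonal entries vanish. Without that entry the block has
  diagonal entries \<open>1\<close> or \<open>-1\<close>, which the braid relation equates.\<close>

lemma swap_block:
  assumes "loop_pair N S R" "x \<in> {1..N}" "y \<in> {1..N}" "x \<noteq> y"
  shows "off S x y = 0 \<and> off S y x = 0 \<and> dg S x y = dg S x x \<and> dg S y x = dg S x x \<and> dg S y y = dg S x x \<or>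
    dg S x y = 0 \<and> dg S y x = 0 \<and> off S x y * off S y x = 1"
proof -
  have S: "S \<in> match_hom N 2 2" "mat_mul N 2 S S = mat_id N 2" and cubic: "cubic_rel N S S S S S S"
    using assms(1) by (auto simp: loop_pair_def)
  have sq: "dg S x y * dg S x y + off S x y * off S y x = 1"
      "dg S y x * dg S y x + off S y x * off S x y = 1"
      "dg S x y * off S x y + off S x y * dg S y x = 0"
      "dg S y x * off S y x + off S y x * dg S x y = 0"
    using coeffs_mul[OF S(1,1) assms(2,3)] coeffs_mul[OF S(1,1) assms(3,2)] assms(4)
      coeffs_id[OF assms(2,3)] coeffs_id[OF assms(3,2)] by (simp_all add: S(2))
  note xy = cubic_rel_two_letters[OF cubic S(1) S(1) S(1) S(1) S(1) S(1) assms(2,3,4)]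
  note yx = cubic_rel_two_letters[OF cubic S(1) S(1) S(1) S(1) S(1) S(1) assms(3,2) assms(4)[symmetric]]
  show ?thesis
  proof (cases "off S x y = 0")
    case True
    then have p: "dg S x y * dg S x y = 1" and q: "dg S y x * dg S y x = 1"
      using sq by simp_all
    then have nz: "dg S x y \<noteq> 0" "dg S y x \<noteq> 0"
      by auto
    have "dg S x y * dg S y x * dg S x y = dg S y x * dg S x y * dg S y x"
      using xy(4) True by simp
    then have pq: "dg S x y = dg S y x"
      using nz by (simp add: mult.commute)
    have "dg S x x * dg S x y * dg S x x = dg S x y * dg S x x * dg S x y"
      using xy(1) True by simp
    moreover have "dg S x x \<noteq> 0" "dg S y y \<noteq> 0"
      using swap_square[OF assms(1,2)] swap_square[OF assms(1,3)] by auto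
    ultimately have "dg S x x = dg S x y"
      using nz by simp
    moreover have "off S y x = 0"
    proof -
      \<comment> \<open>Equal diagonal entries make the trace nonzero, so the other off-diagonal
        entry vanishes as well.\<close>
      have "2 * (dg S x y * off S y x) = 0"
        using sq(4) pq by (simp add: mult.commute)
      then show ?thesis
        using nz by simp
    qed
    moreover have "dg S y y = dg S y x"
      using yx(1) True nz \<open>dg S y y \<noteq> 0\<close> by simp
    ultimately show ?thesis
      using True pq by simp
  next
    case False
    then have sum: "dg S x y + dg S y x = 0"
      using sq(3) by (metis distrib_left mult.commute mult_eq_0_iff)
    have "dg S x y * dg S y x * off S x y = 0"
      using xy(3) by simp
    then have "dg S x y * dg S y x = 0"
      using False by simp
    then have "dg S x y = 0" "dg S y x = 0"
      using sum by auto
    then show ?thesis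
      using sq(1) by simp
  qed
qed

lemma normalise:
  assumes "loop_pair N S R"
  obtains h where "\<And>w. h w \<noteq> 0"
    and "\<And>x y. x \<in> {1..N} \<Longrightarrow> y \<in> {1..N} \<Longrightarrow> off (conj_mat h S) x y = 0 \<or> off (conj_mat h S) x y = 1"
proof -
  \<comment> \<open>Only the increasing word of each pair is rescaled; the opposite entry is its
    inverse and becomes \<open>1\<close> by itself. The weight is nonzero on all lists, so that the
    conjugation can be undone.\<close>
  define h where "h w = (if w ! 0 < w ! 1 \<and> off S (w ! 0) (w ! 1) \<noteq> 0 then 1 / off S (w ! 0) (w ! 1) else 1)" for w
  have nz: "h w \<noteq> 0" for w
    by (simp add: h_def)
  have "off (conj_mat h S) x y = 0 \<or> off (conj_mat h S) x y = 1" if "x \<in> {1..N}" "y \<in> {1..N}" for x y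
  proof (cases "off S x y = 0")
    case False
    then have "x \<noteq> y"
      by auto
    then have inv: "off S x y * off S y x = 1"
      using swap_block[OF assms that] False by auto
    then have "off S y x \<noteq> 0"
      by auto
    with \<open>x \<noteq> y\<close> False inv show ?thesis
      unfolding coeffs_conj(2)[OF nz that]
      by (cases x y rule: linorder_cases) (simp_all add: h_def mult.commute)
  qed (simp add: coeffs_conj(2)[OF nz that])
  then show ?thesis
    using that nz by blast
qed


section \<open>Classification of normalised pairs\<close>

locale normal_pair =
  fixes N :: nat and S R :: cmat
  assumes pair: "loop_pair N S R"
    and normal: "\<And>x y. x \<in> {1..N} \<Longrightarrow> y \<in> {1..N} \<Longrightarrow> off S x y = 0 \<or> off S x y = 1"
begin

lemma hom: "S \<in> match_hom N 2 2" "R \<in> match_hom N 2 2"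
  using pair by (auto simp: loop_pair_def)

lemma cubic: "cubic_rel N S S S S S S" "cubic_rel N R R R R R R"
  "cubic_rel N R R S S R R" "cubic_rel N R S S S S R"
  using pair by (auto simp: loop_pair_def)

lemmas two_letters_I = cubic_rel_two_letters[OF cubic(2) hom(2) hom(2) hom(2) hom(2) hom(2) hom(2)]
lemmas two_letters_II = cubic_rel_two_letters[OF cubic(3) hom(2) hom(2) hom(1) hom(1) hom(2) hom(2)]
lemmas two_letters_III = cubic_rel_two_letters[OF cubic(4) hom(2) hom(1) hom(1) hom(1) hom(1) hom(2)]
lemmas eqs_S = cubic_rel_eqs[OF cubic(1) hom(1) hom(1) hom(1) hom(1) hom(1) hom(1), unfolded cubic_eqs_def]
lemmas eqs_I = cubic_rel_eqs[OF cubic(2) hom(2) hom(2) hom(2) hom(2) hom(2) hom(2), unfolded cubic_eqs_def]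
lemmas eqs_II = cubic_rel_eqs[OF cubic(3) hom(2) hom(2) hom(1) hom(1) hom(2) hom(2), unfolded cubic_eqs_def]
lemmas eqs_III = cubic_rel_eqs[OF cubic(4) hom(2) hom(1) hom(1) hom(1) hom(1) hom(2), unfolded cubic_eqs_def]

abbreviation a :: "nat \<Rightarrow> complex" where "a x \<equiv> dg R x x"
abbreviation b :: "nat \<Rightarrow> complex" where "b x \<equiv> dg S x x"

definition same_county :: "nat \<Rightarrow> nat \<Rightarrow> bool" where
  "same_county x y \<longleftrightarrow> off S x y = 0"

text \<open>Meant as "of the same nation". It is symmetrised because a mixed block has only one
  nonzero diagonal entry.\<close>

definition linked :: "nat \<Rightarrow> nat \<Rightarrow> bool" where
  "linked x y \<longleftrightarrow> dg R x y \<noteq> 0 \<or> dg R y x \<noteq> 0"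

text \<open>In the recipe \<open>\<alpha> + \<beta>\<close> stands at the word beginning in the
  second county. A nation without mixed blocks counts as all top, in accordance with top counties
  being nonempty.\<close>

definition bot :: "nat \<Rightarrow> bool" where
  "bot x \<longleftrightarrow> (\<exists>y\<in>{1..N}. \<not> same_county x y \<and> dg R x y \<noteq> 0)"

lemma b_square: "x \<in> {1..N} \<Longrightarrow> b x * b x = 1"
  using swap_square[OF pair] .

lemma b_cases: "x \<in> {1..N} \<Longrightarrow> b x = 1 \<or> b x = - 1"
  using b_square[of x] by (simp add: square_eq_1_iff)

lemma b_nonzero: "x \<in> {1..N} \<Longrightarrow> b x \<noteq> 0"
  using b_square[of x] by auto

lemma a_nonzero: "x \<in> {1..N} \<Longrightarrow> a x \<noteq> 0"
  using pair det2_nonzero[OF hom(2), of _ x x] by (auto simp: loop_pair_def det2_def)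

lemma det_nonzero: "x \<in> {1..N} \<Longrightarrow> y \<in> {1..N} \<Longrightarrow> det2 R x y \<noteq> 0"
  using pair det2_nonzero[OF hom(2), of _ x y] by (auto simp: loop_pair_def)

lemma same_county_refl [simp]: "same_county x x"
  by (simp add: same_county_def)

text \<open>Where \<open>S\<close> is scalar, the two-letter forms of relation III can be divided by
  the nonzero \<open>b x\<close>, and \<open>R\<close> becomes scalar with the same entry for both
  letters.\<close>

lemma same_countyD:
  assumes "x \<in> {1..N}" "y \<in> {1..N}" "same_county x y"
  shows "off S x y = 0" "dg S x y = b x" "b y = b x" "dg R x y = a x" "a y = a x" "off R x y = 0"
proof -
  have "dg S x y = b x \<and> b y = b x \<and> dg R x y = a x \<and> a y = a x \<and> off R x y = 0"
  proof (cases "x = y")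
    case False
    then have *: "off S x y = 0" "off S y x = 0" "dg S x y = b x" "dg S y x = b x" "b y = b x"
      using swap_block[OF pair assms(1,2)] assms(3) by (auto simp: same_county_def)
    note III = two_letters_III[OF assms(1,2) False] two_letters_III[OF assms(2,1) False[symmetric]]
    have "dg R x y = a x" "off R x y = 0" "dg R x y = dg R y x" "dg R y x = a y"
      using III(1,2,4,7) * b_nonzero[OF assms(1)] by (simp_all add: mult.commute mult.left_commute)
    with * show ?thesis
      by simp
  qed simp
  then show "off S x y = 0" "dg S x y = b x" "b y = b x" "dg R x y = a x" "a y = a x" "off R x y = 0"
    using assms(3) by (auto simp: same_county_def)
qed

lemma diff_countyD:
  assumes "x \<in> {1..N}" "y \<in> {1..N}" "\<not> same_county x y"
  shows "x \<noteq> y" "off S x y = 1" "off S y x = 1" "dg S x y = 0" "dg S y x = 0"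
proof -
  show "x \<noteq> y"
    using assms(3) by auto
  then show "off S x y = 1" "off S y x = 1" "dg S x y = 0" "dg S y x = 0"
    using swap_block[OF pair assms(1,2)] assms normal[OF assms(1,2)] by (auto simp: same_county_def)
qed

lemma same_county_sym: "x \<in> {1..N} \<Longrightarrow> y \<in> {1..N} \<Longrightarrow> same_county x y \<Longrightarrow> same_county y x"
  using diff_countyD(3)[of y x] by (metis same_county_def zero_neq_one)

lemma linked_sym: "linked x y \<Longrightarrow> linked y x"
  by (auto simp: linked_def)

lemma same_county_linked: "x \<in> {1..N} \<Longrightarrow> y \<in> {1..N} \<Longrightarrow> same_county x y \<Longrightarrow> linked x y"
  using same_countyD(4)[of x y] a_nonzero[of x] by (simp add: linked_def)

text \<open>Relation II kills one diagonal entry and fixes both off-diagonal ones. Relation I then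
  makes \<open>a x\<close> and \<open>a y\<close> roots of the characteristic polynomial of the
  block.\<close>

lemma mixed_block:
  assumes x: "x \<in> {1..N}" and y: "y \<in> {1..N}" and flip: "\<not> same_county x y" and nz: "dg R x y \<noteq> 0"
  shows "dg R y x = 0" "dg R x y = a x + a y" "b y = - b x" "off R x y = b y * a y" "off R y x = b x * a x"
proof -
  note flip = diff_countyD[OF x y flip]
  note I = two_letters_I[OF x y flip(1)] two_letters_I[OF y x flip(1)[symmetric]]
  note II = two_letters_II[OF x y flip(1)] two_letters_II[OF y x flip(1)[symmetric]]
  show zero: "dg R y x = 0"
    using II(3) flip nz by simp
  show v: "off R y x = b x * a x"
    using II(1) flip nz by (simp add: mult.commute mult.left_commute)
  have "a y = b y * off R x y"
    using II(12) flip nz by (simp add: mult.commute mult.left_commute)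
  then show u: "off R x y = b y * a y"
    using b_square[OF y] by (metis mult.assoc mult_1)
  \<comment> \<open>The bracket is the characteristic polynomial at \<open>a x\<close>, because the
    other diagonal entry is zero.\<close>
  have "dg R x y * (a x * a x - a x * dg R x y - off R x y * off R y x) = 0"
    using I(1) by (simp add: algebra_simps)
  then have "a x * a x - a x * dg R x y - off R x y * off R y x = 0"
    using nz by simp
  then have "a x * (a x - dg R x y - b x * b y * a y) = 0"
    unfolding u v by (simp add: algebra_simps)
  then have 1: "a x - dg R x y = b x * b y * a y"
    using a_nonzero[OF x] by simp
  have "dg R x y * (a y * a y - a y * dg R x y - off R x y * off R y x) = 0"
    using I(11) by (simp add: algebra_simps)
  then have "a y * a y - a y * dg R x y - off R x y * off R y x = 0"
    using nz by simp
  then have "a y * (a y - dg R x y - b x * b y * a x) = 0"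
    unfolding u v by (simp add: algebra_simps)
  then have 2: "a y - dg R x y = b x * b y * a x"
    using a_nonzero[OF y] by simp
  \<comment> \<open>If \<open>b x * b y\<close> were \<open>1\<close>, adding the equations 1 and 2
    would give \<open>dg R x y = 0\<close>.\<close>
  show "b y = - b x"
    using b_cases[OF x] b_cases[OF y] 1 2 nz by (auto simp: algebra_simps)
  then show "dg R x y = a x + a y"
    using 1 b_square[OF x] by (simp add: algebra_simps)
qed

section \<open>Three letters: counties, nations and the orientation of mixed blocks\<close>

lemma same_county_trans:
  assumes "x \<in> {1..N}" "y \<in> {1..N}" "z \<in> {1..N}" "same_county x y" "same_county y z"
  shows "same_county x z"
proof (rule ccontr)
  assume flip: "\<not> same_county x z"
  then have ne: "x \<noteq> z" "z \<noteq> y" "x \<noteq> y"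
    using assms(4,5) by auto
  note xz = diff_countyD[OF assms(1,3) flip]
  note xy = same_countyD[OF assms(1,2,4)]
  note zy = same_countyD[OF assms(3,2) same_county_sym[OF assms(2,3,5)]]
  \<comment> \<open>On the word \<open>xzy\<close> the flip of \<open>x\<close> and \<open>z\<close>
    produces the term \<open>b x\<close> on one side of the braid relation, while the other side is
    zero.\<close>
  have "b x = 0"
    using eqs_S[OF assms(1,3,2) ne] xz xy zy by simp
  then show False
    using b_nonzero[OF assms(1)] by simp
qed

text \<open>Relation III on \<open>zxy\<close> and \<open>xzy\<close>, divided by
  \<open>b x\<close>, lets \<open>z\<close> see \<open>x\<close> and \<open>y\<close> alike.\<close>

lemma same_county_cong:
  assumes x: "x \<in> {1..N}" and y: "y \<in> {1..N}" and z: "z \<in> {1..N}"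
    and "same_county x y" "\<not> same_county x z"
  shows "\<not> same_county y z" "dg R x z = dg R y z" "dg R z x = dg R z y"
    "off R x z = off R y z" "off R z x = off R z y"
proof -
  show yz: "\<not> same_county y z"
    using assms(5) same_county_trans[OF x y z assms(4)] by blast
  have "dg R x z = dg R y z \<and> dg R z x = dg R z y \<and> off R x z = off R y z \<and> off R z x = off R z y"
  proof (cases "x = y")
    case False
    note zx = diff_countyD[OF x z assms(5)] and zy = diff_countyD[OF y z yz]
    note xy = same_countyD[OF x y assms(4)] same_countyD(1,2,4,6)[OF y x same_county_sym[OF x y assms(4)]]
    show ?thesis
      using eqs_III[OF z x y zx(1)[symmetric] False zy(1)[symmetric]]
        eqs_III[OF x z y zx(1) zy(1)[symmetric] False] zx zy xy b_nonzero[OF x]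
      by (simp add: mult.commute mult.left_commute)
  qed simp
  then show "dg R x z = dg R y z" "dg R z x = dg R z y" "off R x z = off R y z" "off R z x = off R z y"
    by auto
qed

text \<open>A third county cannot join a nation. As \<open>S\<close> flips all three pairs, relation
  II reduces to short products of entries of \<open>R\<close>; invertibility of the blocks and
  relation I supply the rest.\<close>

lemma mixed_triple:
  assumes x: "x \<in> {1..N}" and y: "y \<in> {1..N}" and z: "z \<in> {1..N}"
    and flips: "\<not> same_county x y" "\<not> same_county y z" "\<not> same_county x z"
    and nz: "dg R x z \<noteq> 0"
  shows "dg R x y = 0" "dg R y x = 0" "dg R y z = 0" "dg R z y = 0"
    "off R x y = off R z y" "off R y x = off R y z"
proof -
  note xy = diff_countyD[OF x y flips(1)] and yz = diff_countyD[OF y z flips(2)]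
    and xz = diff_countyD[OF x z flips(3)]
  note ne = xy(1) yz(1) xz(1)
  have II: "off R x y * dg R x z = dg R x z * off R z y" "dg R x z * dg R z y = 0"
    using eqs_II[OF x y z ne] xy yz xz by simp_all
  show u: "off R x y = off R z y" and zy: "dg R z y = 0"
    using II nz by simp_all
  show yx: "dg R y x = 0"
    using eqs_II[OF y x z ne(1)[symmetric] ne(3) ne(2)] xy yz xz nz by simp
  have unz: "off R x y \<noteq> 0"
    using det_nonzero[OF x y] yx by (auto simp: det2_def)
  have vnz: "off R y z \<noteq> 0"
    using det_nonzero[OF y z] zy by (auto simp: det2_def)
  \<comment> \<open>This removes the one cubic term in relation I that would keep
    \<open>dg R y z\<close> alive.\<close>
  have chain: "dg R x y * dg R y z = 0"
    using eqs_II[OF x y z ne] xy yz xz by simp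
  have "dg R y z * off R x y * dg R x z = 0"
    using eqs_I[OF x y z ne] chain yx by auto
  then show yz0: "dg R y z = 0"
    using nz unz by simp
  have "dg R x y * off R y z * dg R x z = 0"
    using eqs_I[OF x y z ne] zy yz0 by auto
  then show "dg R x y = 0"
    using nz vnz by simp
  have "off R x y * dg R x z * off R y x = off R y z * dg R x z * off R z y"
    using eqs_I[OF x y z ne] yz0 by simp
  then show "off R y x = off R y z"
    using u nz unz by (simp add: mult.commute mult.left_commute)
qed

lemma linked_refl: "x \<in> {1..N} \<Longrightarrow> linked x x"
  using a_nonzero by (simp add: linked_def)

lemma linked_trans:
  assumes x: "x \<in> {1..N}" and y: "y \<in> {1..N}" and z: "z \<in> {1..N}" and "linked x y" "linked y z"
  shows "linked x z"
proof (cases "same_county x z")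
  case True
  then show ?thesis
    using same_county_linked x z by blast
next
  case xz: False
  consider "same_county x y" | "same_county y z" | "\<not> same_county x y" "\<not> same_county y z"
    by blast
  then show ?thesis
  proof cases
    case 1
    then show ?thesis
      using same_county_cong[OF x y z 1 xz] assms(5) by (simp add: linked_def)
  next
    case 2
    then have "\<not> same_county z x" "same_county z y"
      using xz same_county_sym[OF y z] same_county_sym[OF z x] by blast+
    then show ?thesis
      using same_county_cong[OF z y x] assms(4) by (simp add: linked_def)
  next
    \<comment> \<open>All three counties differ, so \<open>mixed_triple\<close> contradicts the two
      links: the case is void.\<close>
    case 3
    have sym: "\<not> same_county z y" "\<not> same_county y x" "\<not> same_county z x"
      using 3 xz same_county_sym[OF z y] same_county_sym[OF y x] same_county_sym[OF z x] by blast+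
    show ?thesis
      using mixed_triple(3,4)[OF x z y xz sym(1) 3(1)] mixed_triple(1,2)[OF y z x 3(2) sym(3,2)]
        assms(4,5) by (auto simp: linked_def)
  qed
qed

text \<open>Linked letters share a county or form a mixed block, and an outsider \<open>z\<close>
  cannot distinguish them in either case. Hence cross entries descend to nations.\<close>

lemma linked_cong:
  assumes x: "x \<in> {1..N}" and y: "y \<in> {1..N}" and z: "z \<in> {1..N}" and "linked x y" "\<not> linked x z"
  shows "off R x z = off R y z" "off R z x = off R z y"
proof -
  have "\<not> linked y z"
    using assms(5) linked_trans[OF x y z assms(4)] by blast
  then have xz: "\<not> same_county x z" and zx: "\<not> same_county z x"
    and yz: "\<not> same_county y z" and zy: "\<not> same_county z y"
    using assms(5) linked_sym[of z x] linked_sym[of z y] same_county_linked x y z by blast+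
  have "off R x z = off R y z \<and> off R z x = off R z y"
  proof (cases "same_county x y")
    case True
    then show ?thesis
      using same_county_cong[OF x y z _ xz] by blast
  next
    case False
    then have "\<not> same_county y x"
      using same_county_sym[OF y x] by blast
    then show ?thesis
      using mixed_triple(5,6)[OF x z y xz zy False] mixed_triple(5,6)[OF y z x yz zx] assms(4)
      by (auto simp: linked_def)
  qed
  then show "off R x z = off R y z" "off R z x = off R z y"
    by auto
qed

lemma bot_same_county:
  assumes "x \<in> {1..N}" "y \<in> {1..N}" "same_county x y"
  shows "bot x \<longleftrightarrow> bot y"
proof -
  have "bot v" if uv: "u \<in> {1..N}" "v \<in> {1..N}" "same_county u v" "bot u" for u v
  proof -
    obtain z where z: "z \<in> {1..N}" "\<not> same_county u z" "dg R u z \<noteq> 0"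
      using uv(4) by (auto simp: bot_def)
    then show ?thesis
      using same_county_cong[OF uv(1,2) z(1) uv(3) z(2)] uv(2) by (auto simp: bot_def)
  qed
  then show ?thesis
    using assms same_county_sym[OF assms] by blast
qed

text \<open>A witness \<open>z\<close> for \<open>bot y\<close> either shares the county of
  \<open>x\<close>, giving the block of \<open>x\<close> and \<open>y\<close> two nonzero diagonal
  entries, or lies in a third county, where \<open>mixed_triple\<close> forces
  \<open>dg R y z = 0\<close>.\<close>

lemma mixed_bot:
  assumes x: "x \<in> {1..N}" and y: "y \<in> {1..N}" and flip: "\<not> same_county x y" and nz: "dg R x y \<noteq> 0"
  shows "bot x" "\<not> bot y"
proof -
  show "bot x"
    using assms by (auto simp: bot_def)
  show "\<not> bot y"
  proof
    assume "bot y"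
    then obtain z where z: "z \<in> {1..N}" "\<not> same_county y z" "dg R y z \<noteq> 0"
      by (auto simp: bot_def)
    show False
    proof (cases "same_county x z")
      case True
      then have "dg R y x = dg R y z"
        using same_county_cong(3)[OF x z(1) y True flip] by simp
      then show False
        using mixed_block(1)[OF x y flip nz] z(3) by simp
    next
      case False
      then have "\<not> same_county z y"
        using z(2) same_county_sym[OF z(1) y] by blast
      then show False
        using mixed_triple(4)[OF x z(1) y False _ flip nz] z(3) by simp
    qed
  qed
qed

text \<open>A link across counties has one nonzero diagonal entry, which separates its members by
  \<open>bot\<close>. A nation therefore has at most two counties.\<close>

lemma same_county_iff:
  assumes "x \<in> {1..N}" "y \<in> {1..N}" "linked x y"
  shows "same_county x y \<longleftrightarrow> bot x = bot y"
proof
  show "bot x = bot y" if "same_county x y"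
    using bot_same_county assms that by blast
  show "same_county x y" if "bot x = bot y"
  proof (rule ccontr)
    assume "\<not> same_county x y"
    moreover from this have "\<not> same_county y x"
      using same_county_sym[OF assms(2,1)] by blast
    ultimately show False
      using mixed_bot[OF assms(1,2)] mixed_bot[OF assms(2,1)] assms(3) that by (auto simp: linked_def)
  qed
qed

lemma bot_top_block:
  assumes x: "x \<in> {1..N}" and y: "y \<in> {1..N}" and "linked x y" "bot x" "\<not> bot y"
  shows "\<not> same_county x y" "dg R y x = 0" "dg R x y = a x + a y" "dg R x y \<noteq> 0" "b y = - b x"
    "off R x y = b y * a y" "off R y x = b x * a x"
proof -
  show flip: "\<not> same_county x y"
    using same_county_iff[OF x y] assms by blast
  then have "\<not> same_county y x"
    using same_county_sym[OF y x] by blast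
  then have "dg R y x = 0"
    using assms(5) x by (auto simp: bot_def)
  then show nz: "dg R x y \<noteq> 0"
    using assms(3) by (auto simp: linked_def)
  show "dg R y x = 0" "dg R x y = a x + a y" "b y = - b x"
    "off R x y = b y * a y" "off R y x = b x * a x"
    using mixed_block[OF x y flip nz] by simp_all
qed

section \<open>Reading off the nations and their signs\<close>

definition nat_sign :: "nat \<Rightarrow> int" where
  "nat_sign x = (if bot x \<longleftrightarrow> b x = 1 then - 1 else 1)"

definition nation :: "nat \<Rightarrow> nation" where
  "nation x = Nation {y \<in> {1..N}. linked x y \<and> \<not> bot y} {y \<in> {1..N}. linked x y \<and> bot y} (nat_sign x)"

definition index :: "nation set" where
  "index = nation ` {1..N}"

lemma residents_nation: "residents (nation x) = {y \<in> {1..N}. linked x y}"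
  by (auto simp: residents_def nation_def)

text \<open>The sign of a nation is \<open>b\<close> on its top county; a resident of the second
  county supplies it with the opposite sign.\<close>

lemma nat_sign: "x \<in> {1..N} \<Longrightarrow> b x = (if bot x then - of_int (nat_sign x) else of_int (nat_sign x))"
  using b_cases[of x] by (auto simp: nat_sign_def)

lemma nation_eq_iff:
  assumes "x \<in> {1..N}" "y \<in> {1..N}"
  shows "nation x = nation y \<longleftrightarrow> linked x y"
proof
  assume "nation x = nation y"
  then have "y \<in> residents (nation x)"
    using linked_refl assms by (simp add: residents_nation)
  then show "linked x y"
    by (simp add: residents_nation)
next
  assume link: "linked x y"
  \<comment> \<open>Crossing to the other county reverses both \<open>bot\<close> and
    \<open>b\<close>, so the sign does not depend on the resident.\<close>
  have "nat_sign x = nat_sign y"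
  proof (cases "same_county x y")
    case True
    then show ?thesis
      using same_county_iff[OF assms link] same_countyD(3)[OF assms] by (simp add: nat_sign_def)
  next
    case False
    then have "bot x \<noteq> bot y"
      using same_county_iff[OF assms link] by simp
    moreover from this have "b y = - b x"
      using bot_top_block(5)[OF assms link] bot_top_block(5)[OF assms(2,1) linked_sym[OF link]]
      by (cases "bot x") simp_all
    ultimately show ?thesis
      using b_cases[OF assms(1)] by (auto simp: nat_sign_def)
  qed
  moreover have "linked x z \<longleftrightarrow> linked y z" if "z \<in> {1..N}" for z
    using linked_trans[OF assms that link] linked_trans[OF assms(2,1) that linked_sym[OF link]] by blast
  ultimately show "nation x = nation y"
    unfolding nation_def by auto
qed

lemma residents_eqD:
  assumes "x \<in> {1..N}" "y \<in> {1..N}" "residents (nation x) \<inter> residents (nation y) \<noteq> {}"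
  shows "nation x = nation y"
proof -
  obtain z where "z \<in> {1..N}" "linked x z" "linked y z"
    using assms(3) by (auto simp: residents_nation)
  then show ?thesis
    using nation_eq_iff assms(1,2) by metis
qed

lemma index_in: "index \<in> index_set N"
proof -
  have self: "x \<in> residents (nation x)" if "x \<in> {1..N}" for x
    using linked_refl that by (simp add: residents_nation)
  have "partition_on {1..N} (residents ` index)"
  proof (rule partition_onI)
    show "\<Union> (residents ` index) = {1..N}"
      using self by (auto simp: index_def residents_nation)
    show "{} \<notin> residents ` index"
      using self unfolding index_def by (metis empty_iff imageE)
    show "disjnt p q" if pq: "p \<in> residents ` index" "q \<in> residents ` index" "p \<noteq> q" for p q
    proof -
      obtain x y where "x \<in> {1..N}" "p = residents (nation x)" "y \<in> {1..N}" "q = residents (nation y)"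
        using pq(1,2) by (auto simp: index_def)
      then show ?thesis
        using residents_eqD[of x y] pq(3) unfolding disjnt_def by metis
    qed
  qed
  moreover have "inj_on residents index"
  proof (rule inj_onI)
    fix n n'
    assume n: "n \<in> index" "n' \<in> index" and eq: "residents n = residents n'"
    obtain x y where xy: "x \<in> {1..N}" "n = nation x" "y \<in> {1..N}" "n' = nation y"
      using n by (auto simp: index_def)
    then have "y \<in> residents (nation x)"
      using self[OF xy(3)] eq by simp
    then show "n = n'"
      using residents_eqD[OF xy(1,3)] self[OF xy(3)] xy(2,4) by auto
  qed
  \<comment> \<open>The witness that puts \<open>x\<close> into the second county is itself a top
    resident.\<close>
  moreover have "top_county (nation x) \<noteq> {}" if "x \<in> {1..N}" for x
  proof (cases "bot x")
    case True
    then obtain y where "y \<in> {1..N}" "\<not> same_county x y" "dg R x y \<noteq> 0"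
      by (auto simp: bot_def)
    then show ?thesis
      using mixed_bot(2)[OF that] by (auto simp: nation_def linked_def)
  next
    case False
    then show ?thesis
      using linked_refl that by (auto simp: nation_def)
  qed
  ultimately show ?thesis
    by (auto simp: index_set_def index_def nation_def nat_sign_def)
qed

lemma nation_of_index:
  assumes "x \<in> {1..N}"
  shows "nation_of index x = nation x"
  using nation_of_eq[OF index_in] assms linked_refl by (simp add: index_def residents_nation)

lemma is_top_index:
  assumes "x \<in> {1..N}"
  shows "is_top index x \<longleftrightarrow> \<not> bot x"
  using assms linked_refl by (simp add: is_top_def nation_of_index nation_def)

section \<open>Reading off the parameters\<close>

definition top_rep :: "nation \<Rightarrow> nat" where
  "top_rep n = (SOME x. x \<in> top_county n)"

definition bot_rep :: "nation \<Rightarrow> nat" where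
  "bot_rep n = (SOME x. x \<in> bottom_county n)"

definition nation_at :: "nat \<Rightarrow> nation" where
  "nation_at s = inv_into index (rank index) s"

definition cross_par :: "nation \<Rightarrow> nation \<Rightarrow> complex" where
  "cross_par n n' = off R (top_rep n) (top_rep n')"

text \<open>With \<open>c\<close> and \<open>c'\<close> the cross entries in the two directions,
  \<open>\<mu> C = c\<close> and \<open>\<mu> / C = c'\<close> are solved by a square root
  \<open>C\<close> of \<open>c / c'\<close> and \<open>\<mu> = c / C\<close>. The default
  \<open>1\<close> spares a proof that every position up to \<open>card index\<close> is a
  rank.\<close>

definition coords :: params where
  "coords = \<lparr>
     par_alpha = (\<lambda>s. a (top_rep (nation_at s))),
     par_beta = (\<lambda>s. a (bot_rep (nation_at s))),
     par_mu = (\<lambda>s t. if s \<in> rank index ` index \<and> t \<in> rank index ` index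
       then cross_par (nation_at s) (nation_at t) /
         csqrt (cross_par (nation_at s) (nation_at t) / cross_par (nation_at t) (nation_at s)) else 1),
     par_C = (\<lambda>s t. if s \<in> rank index ` index \<and> t \<in> rank index ` index
       then csqrt (cross_par (nation_at s) (nation_at t) / cross_par (nation_at t) (nation_at s)) else 1) \<rparr>"

lemma nation_at_rank: "n \<in> index \<Longrightarrow> nation_at (rank index n) = n"
  unfolding nation_at_def using rank_eq_iff[OF index_in] by (intro inv_into_f_f) (auto simp: inj_on_def)

lemma top_rep:
  assumes "x \<in> {1..N}"
  shows "top_rep (nation x) \<in> {1..N}" "linked x (top_rep (nation x))" "\<not> bot (top_rep (nation x))"
proof -
  have "top_county (nation x) \<noteq> {}"
    using index_setD(9)[OF index_in] assms by (simp add: index_def)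
  then have "top_rep (nation x) \<in> top_county (nation x)"
    unfolding top_rep_def by (metis all_not_in_conv someI_ex)
  then show "top_rep (nation x) \<in> {1..N}" "linked x (top_rep (nation x))" "\<not> bot (top_rep (nation x))"
    by (auto simp: nation_def)
qed

lemma bot_rep:
  assumes "x \<in> {1..N}" "bottom_county (nation x) \<noteq> {}"
  shows "bot_rep (nation x) \<in> {1..N}" "linked x (bot_rep (nation x))" "bot (bot_rep (nation x))"
proof -
  have "bot_rep (nation x) \<in> bottom_county (nation x)"
    unfolding bot_rep_def using assms(2) by (metis all_not_in_conv someI_ex)
  then show "bot_rep (nation x) \<in> {1..N}" "linked x (bot_rep (nation x))" "bot (bot_rep (nation x))"
    by (auto simp: nation_def)
qed

lemma cross_par_nation:
  assumes "x \<in> {1..N}" "y \<in> {1..N}" "\<not> linked x y"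
  shows "cross_par (nation x) (nation y) = off R x y" "off R x y \<noteq> 0"
proof -
  have "\<not> linked y x"
    using assms(3) linked_sym by blast
  then have "\<not> linked y (top_rep (nation x))"
    using linked_trans[OF assms(2) top_rep(1)[OF assms(1)] assms(1)] linked_sym[OF top_rep(2)[OF assms(1)]] by blast
  then have "off R (top_rep (nation x)) y = off R (top_rep (nation x)) (top_rep (nation y))"
    using linked_cong(2)[OF assms(2) _ _ top_rep(2)[OF assms(2)]] top_rep(1) assms by blast
  moreover have "off R x y = off R (top_rep (nation x)) y"
    using linked_cong(1)[OF assms(1) top_rep(1)[OF assms(1)] assms(2) top_rep(2)[OF assms(1)] assms(3)] .
  ultimately show "cross_par (nation x) (nation y) = off R x y"
    by (simp add: cross_par_def)
  show "off R x y \<noteq> 0"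
    using det_nonzero[OF assms(1,2)] assms(3) by (auto simp: linked_def det2_def)
qed

lemma cross_par_nonzero:
  assumes "n \<in> index" "n' \<in> index" "n \<noteq> n'"
  shows "cross_par n n' \<noteq> 0"
  using assms cross_par_nation by (auto simp: index_def nation_eq_iff)

text \<open>In increasing order of ranks the square root cancels at once; in decreasing order it
  occurs squared, and dividing by the quotient of the two entries turns one into the other.\<close>

lemma cross_coords:
  assumes "n \<in> index" "n' \<in> index" "n \<noteq> n'"
  shows "cross index coords n n' = cross_par n n'"
proof -
  have ne: "rank index n \<noteq> rank index n'"
    using rank_eq_iff[OF index_in] assms by simp
  note nz = cross_par_nonzero[OF assms] cross_par_nonzero[OF assms(2,1) assms(3)[symmetric]]
  have sq: "csqrt c * csqrt c = c" for c
    using power2_csqrt[of c] by (simp add: power2_eq_square)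
  show ?thesis
    using ne nz assms
    by (auto simp: cross_def mu_def C_par_def coords_def nation_at_rank sq neq_iff)
qed

lemma coords_in: "(index, coords) \<in> param_index_set N"
proof -
  have "par_alpha coords (rank index n) \<noteq> 0 \<and> (bottom_county n \<noteq> {} \<longrightarrow>
      par_beta coords (rank index n) \<noteq> 0 \<and> par_alpha coords (rank index n) + par_beta coords (rank index n) \<noteq> 0)"
    if n: "n \<in> index" for n
  proof -
    obtain x where x: "x \<in> {1..N}" "n = nation x"
      using n by (auto simp: index_def)
    note t = top_rep[OF x(1)]
    \<comment> \<open>The sum is the nonzero diagonal entry of the mixed block on the two
      representatives.\<close>
    have "a (bot_rep n) \<noteq> 0 \<and> a (top_rep n) + a (bot_rep n) \<noteq> 0" if "bottom_county n \<noteq> {}"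
    proof -
      note bt = bot_rep[OF x(1) that[unfolded x(2)]]
      have "linked (bot_rep n) (top_rep n)"
        using linked_trans[OF bt(1) x(1) t(1)] linked_sym[OF bt(2)] t(2) x(2) by blast
      then show ?thesis
        using bot_top_block(3,4)[OF bt(1) t(1)] bt t a_nonzero[OF bt(1)] by (simp add: x(2) add.commute)
    qed
    then show ?thesis
      using a_nonzero[OF t(1)] nation_at_rank[OF n] by (simp add: coords_def x(2))
  qed
  moreover have "par_mu coords s t \<noteq> 0 \<and> par_C coords s t \<noteq> 0" if "s < t" for s t
  proof (cases "s \<in> rank index ` index \<and> t \<in> rank index ` index")
    case True
    then obtain n n' where n: "n \<in> index" "n' \<in> index" "s = rank index n" "t = rank index n'"
      by auto
    then have "n \<noteq> n'"
      using that by auto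
    then show ?thesis
      using n cross_par_nonzero[of n n'] cross_par_nonzero[of n' n] by (simp add: coords_def nation_at_rank)
  next
    case False
    then show ?thesis
      by (auto simp: coords_def)
  qed
  ultimately show ?thesis
    using index_in by (simp add: param_index_set_def param_space_def)
qed

lemma a_top_rep: "x \<in> {1..N} \<Longrightarrow> \<not> bot x \<Longrightarrow> a x = a (top_rep (nation x))"
  using same_countyD(5) same_county_iff top_rep by metis

lemma a_bot_rep:
  assumes "x \<in> {1..N}" "bot x"
  shows "a x = a (bot_rep (nation x))"
proof -
  have "bottom_county (nation x) \<noteq> {}"
    using assms linked_refl by (auto simp: nation_def)
  note * = bot_rep[OF assms(1) this]
  then have "same_county x (bot_rep (nation x))"
    using same_county_iff assms by blast
  then show ?thesis
    using same_countyD(5)[OF assms(1) *(1)] by simp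
qed

lemma recipe_index: "recipe N (index, coords) = (S, R)"
proof -
  define S' R' where "S' = fst (recipe N (index, coords))" and "R' = snd (recipe N (index, coords))"
  have hom': "S' \<in> match_hom N 2 2" "R' \<in> match_hom N 2 2"
    by (simp_all add: S'_def R'_def recipe_in_hom)
  have eq: "dg S' i j = dg S i j \<and> off S' i j = off S i j \<and> dg R' i j = dg R i j \<and> off R' i j = off R i j"
    if i: "i \<in> {1..N}" and j: "j \<in> {1..N}" for i j
  proof -
    have in_index: "nation i \<in> index" "nation j \<in> index"
      using i j by (auto simp: index_def)
    have sign: "complex_of_int (sign (nation i)) = of_int (nat_sign i)"
      by (simp add: nation_def)
    note coeffs = recipe_coeffs[OF index_in i j, of coords, folded S'_def R'_def,
        unfolded nation_of_index[OF i] nation_of_index[OF j] is_top_index[OF i] is_top_index[OF j] sign]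
    have al: "par_alpha coords (rank index (nation i)) = a (top_rep (nation i))"
      and be: "par_beta coords (rank index (nation i)) = a (bot_rep (nation i))"
      using nation_at_rank[OF in_index(1)] by (simp_all add: coords_def)
    show ?thesis
    proof (cases "linked i j")
      case False
      then have ne: "nation i \<noteq> nation j"
        using nation_eq_iff i j by blast
      have flip: "\<not> same_county i j"
        using False same_county_linked i j by blast
      show ?thesis
        using diff_countyD[OF i j flip] ne False cross_par_nation[OF i j False] cross_coords[OF in_index ne]
        by (simp add: coeffs linked_def)
    next
      case True
      then have eq: "nation i = nation j"
        using nation_eq_iff i j by blast
      note bi = nat_sign[OF i] and bj = nat_sign[OF j]
      have sg: "nat_sign j = nat_sign i"
        using eq by (simp add: nation_def)
      consider "bot i = bot j" | "bot i" "\<not> bot j" | "\<not> bot i" "bot j"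
        by blast
      then show ?thesis
      proof cases
        case 1
        then have "same_county i j"
          using same_county_iff[OF i j True] by simp
        note sc = same_countyD[OF i j this]
        show ?thesis
          using 1 eq al be sc bi a_top_rep[OF i] a_bot_rep[OF i] by (cases "bot i") (simp_all add: coeffs)
      next
        case 2
        note block = bot_top_block[OF i j True 2]
        note flip = diff_countyD[OF i j block(1)]
        show ?thesis
          using 2 eq al be flip block(2,3,6) bj sg a_top_rep[OF j] a_bot_rep[OF i]
          by (simp add: coeffs)
      next
        case 3
        note block = bot_top_block[OF j i linked_sym[OF True] 3(2,1)]
        note flip = diff_countyD[OF j i block(1)]
        show ?thesis
          using 3 eq al be flip block(2,3,7) bj sg a_top_rep[OF i] a_bot_rep[OF j]
          by (simp add: coeffs)
      qed
    qed
  qed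
  have "S' = S"
    by (rule match_hom_2_eqI[OF hom'(1) hom(1)]) (use eq in blast)
  moreover have "R' = R"
    by (rule match_hom_2_eqI[OF hom'(2) hom(2)]) (use eq in blast)
  ultimately show ?thesis
    by (simp add: S'_def R'_def prod_eq_iff)
qed

end


section \<open>Symmetries\<close>

text \<open>Restricted to \<open>match_pairs N\<close> because elements of \<open>BijGroup\<close>
  are extensional on their carrier.\<close>

definition conj_sym :: "nat \<Rightarrow> (nat list \<Rightarrow> complex) \<Rightarrow> cmat \<times> cmat \<Rightarrow> cmat \<times> cmat" where
  "conj_sym N h = (\<lambda>(S, R)\<in>match_pairs N. (conj_mat h S, conj_mat h R))"

definition perm_sym :: "nat \<Rightarrow> (nat \<Rightarrow> nat) \<Rightarrow> cmat \<times> cmat \<Rightarrow> cmat \<times> cmat" where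
  "perm_sym N w = (\<lambda>(S, R)\<in>match_pairs N. (relabel w S, relabel w R))"

definition diag_mat :: "nat \<Rightarrow> (nat list \<Rightarrow> complex) \<Rightarrow> cmat" where
  "diag_mat N h = (\<lambda>u v. if u \<in> words N 2 \<and> u = v then h u else 0)"

lemma diag_mat_in_hom: "diag_mat N h \<in> match_hom N 2 2"
  by (auto simp: match_hom_def diag_mat_def split: if_splits)

lemma mat_mul_diag_left:
  assumes "M \<in> match_hom N 2 2"
  shows "mat_mul N 2 (diag_mat N h) M = (\<lambda>u v. h u * M u v)"
proof (intro ext)
  fix u v
  have "mat_mul N 2 (diag_mat N h) M u v = (\<Sum>w\<in>words N 2. if w = u then h u * M u v else 0)"
    unfolding mat_mul_def diag_mat_def by (intro sum.cong) auto
  then show "mat_mul N 2 (diag_mat N h) M u v = h u * M u v"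
    using hom_zeroI[OF assms, of u v] by auto
qed

lemma mat_mul_diag_right:
  assumes "M \<in> match_hom N 2 2"
  shows "mat_mul N 2 M (diag_mat N h) = (\<lambda>u v. M u v * h v)"
proof (intro ext)
  fix u v
  have "mat_mul N 2 M (diag_mat N h) u v = (\<Sum>w\<in>words N 2. if w = v then M u v * h v else 0)"
    unfolding mat_mul_def diag_mat_def by (intro sum.cong) auto
  then show "mat_mul N 2 M (diag_mat N h) u v = M u v * h v"
    using hom_zeroI[OF assms, of u v] by auto
qed

lemma conj_sym_in:
  assumes "\<And>w. h w \<noteq> 0"
  shows "conj_sym N h \<in> x_symmetries N"
proof -
  let ?X = "diag_mat N h" and ?Y = "diag_mat N (\<lambda>w. 1 / h w)"
  have "mat_mul N 2 ?X ?Y = mat_id N 2" "mat_mul N 2 ?Y ?X = mat_id N 2"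
    using assms by (auto simp: mat_mul_diag_left diag_mat_in_hom, auto simp: diag_mat_def mat_id_def fun_eq_iff)
  moreover have "mat_mul N 2 (mat_mul N 2 ?X M) ?Y = conj_mat h M" if "M \<in> match_hom N 2 2" for M
    using mat_mul_diag_right[OF mat_mul_in_hom[OF diag_mat_in_hom that]]
    by (simp add: mat_mul_diag_left that conj_mat_def)
  then have "conj_sym N h = x_map N ?X ?Y"
    unfolding conj_sym_def x_map_def by (intro restrict_ext) (auto simp: match_pairs_def)
  moreover have "\<forall>u v. ?X u v \<noteq> 0 \<longrightarrow> u = v"
    by (auto simp: diag_mat_def)
  ultimately show ?thesis
    unfolding x_symmetries_def using diag_mat_in_hom by blast
qed

lemma conj_mat_inverse:
  assumes "\<And>w. h w \<noteq> 0"
  shows "conj_mat (\<lambda>w. 1 / h w) (conj_mat h M) = M" "conj_mat h (conj_mat (\<lambda>w. 1 / h w) M) = M"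
  using assms by (simp_all add: conj_mat_def fun_eq_iff)

lemma conj_sym_Bij:
  assumes "\<And>w. h w \<noteq> 0"
  shows "conj_sym N h \<in> Bij (match_pairs N)"
proof -
  have "bij_betw (conj_sym N h) (match_pairs N) (match_pairs N)"
    by (rule bij_betw_byWitness[where f' = "conj_sym N (\<lambda>w. 1 / h w)"])
      (auto simp: conj_sym_def match_pairs_def conj_mat_in_hom conj_mat_inverse[OF assms])
  then show ?thesis
    by (simp add: Bij_def conj_sym_def)
qed

lemma relabel_in_hom:
  assumes "w permutes {1..N}" "M \<in> match_hom N n n"
  shows "relabel w M \<in> match_hom N n n"
  unfolding match_hom_def
proof (intro CollectI allI impI)
  fix u v
  assume "relabel w M u v \<noteq> 0"
  then have *: "map w u \<in> words N n" "map w v \<in> words N n" "mset (map w u) = mset (map w v)"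
    using assms(2) unfolding relabel_def match_hom_def by blast+
  have "u \<in> words N n" if "map w u \<in> words N n" for u
    using that permutes_in_image[OF assms(1)] by (auto simp: words_def)
  moreover have "mset u = mset v"
    using *(3) injD[OF multiset.inj_map[OF permutes_inj[OF assms(1)]]] by simp
  ultimately show "u \<in> words N n \<and> v \<in> words N n \<and> mset u = mset v"
    using * by blast
qed

lemma perm_sym_in: "w permutes {1..N} \<Longrightarrow> perm_sym N w \<in> perm_symmetries N"
  unfolding perm_symmetries_def perm_sym_def by blast

lemma perm_sym_Bij:
  assumes "w permutes {1..N}"
  shows "perm_sym N w \<in> Bij (match_pairs N)"
proof -
  have inv: "relabel w (relabel (inv_into UNIV w) M) = M" "relabel (inv_into UNIV w) (relabel w M) = M" for M
    using permutes_inverses[OF assms] by (simp_all add: relabel_def fun_eq_iff comp_def)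
  have "bij_betw (perm_sym N w) (match_pairs N) (match_pairs N)"
    by (rule bij_betw_byWitness[where f' = "perm_sym N (inv_into UNIV w)"])
      (auto simp: perm_sym_def match_pairs_def relabel_in_hom[OF assms]
        relabel_in_hom[OF permutes_inv[OF assms]] inv)
  then show ?thesis
    by (simp add: Bij_def perm_sym_def)
qed

text \<open>The multiplication of \<open>BijGroup\<close> is composition only on actual bijections,
  hence the appeal to both \<open>Bij\<close> lemmas.\<close>

lemma conj_perm_in_symmetry_group:
  assumes "\<And>w. h w \<noteq> 0" "f permutes {1..N}"
  shows "compose (match_pairs N) (conj_sym N h) (perm_sym N f) \<in> symmetry_group N"
proof -
  have "conj_sym N h \<otimes>\<^bsub>BijGroup (match_pairs N)\<^esub> perm_sym N f \<in> symmetry_group N"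
    unfolding symmetry_group_def
    using conj_sym_in[OF assms(1)] perm_sym_in[OF assms(2)] by (intro generate.eng generate.incl) auto
  then show ?thesis
    using conj_sym_Bij[OF assms(1)] perm_sym_Bij[OF assms(2)] by (simp add: BijGroup_def)
qed


section \<open>Relabelling to standard index sets\<close>

definition image_nation :: "(nat \<Rightarrow> nat) \<Rightarrow> nation \<Rightarrow> nation" where
  "image_nation f n = Nation (f ` top_county n) (f ` bottom_county n) (sign n)"

lemma image_nation_simps [simp]:
  "top_county (image_nation f n) = f ` top_county n"
  "bottom_county (image_nation f n) = f ` bottom_county n"
  "sign (image_nation f n) = sign n"
  "residents (image_nation f n) = f ` residents n"
  by (auto simp: image_nation_def residents_def)

lemma inj_image_nation: "inj f \<Longrightarrow> inj (image_nation f)"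
  by (intro injI nation.expand) (auto simp: image_nation_def inj_image_eq_iff)

text \<open>Coefficients depend on letters only through nation, county and rank. A relabelling that
  preserves ranks therefore leaves the parameters valid. Since \<open>relabel f\<close> reads
  entries at the letters \<open>f i\<close>, it leads from the image index back to the
  original.\<close>

lemma recipe_image_nation:
  assumes p: "(\<Lambda>, x) \<in> param_index_set N" and f: "f permutes {1..N}"
    and \<Lambda>'_def: "\<Lambda>' = image_nation f ` \<Lambda>"
    and rank: "\<And>n. n \<in> \<Lambda> \<Longrightarrow> rank \<Lambda>' (image_nation f n) = rank \<Lambda> n"
  shows "(\<Lambda>', x) \<in> param_index_set N"
    and "perm_sym N f (recipe N (\<Lambda>', x)) = recipe N (\<Lambda>, x)"
proof -
  have \<Lambda>: "\<Lambda> \<in> index_set N" and x: "x \<in> param_space \<Lambda>"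
    using p by (auto simp: param_index_set_def)
  note inj = permutes_inj[OF f]
  have image: "f ` {1..N} = {1..N}"
    using permutes_image[OF f] .
  have "partition_on {1..N} (residents ` \<Lambda>')"
  proof (rule partition_onI)
    have "\<Union> (residents ` \<Lambda>') = f ` \<Union> (residents ` \<Lambda>)"
      by (auto simp: \<Lambda>'_def)
    moreover have "\<Union> (residents ` \<Lambda>) = {1..N}"
      using index_setD(2,5)[OF \<Lambda>] by blast
    ultimately show "\<Union> (residents ` \<Lambda>') = {1..N}"
      using image by simp
    show "{} \<notin> residents ` \<Lambda>'"
      using index_setD(4)[OF \<Lambda>] by (auto simp: \<Lambda>'_def)
    show "disjnt P Q" if PQ: "P \<in> residents ` \<Lambda>'" "Q \<in> residents ` \<Lambda>'" "P \<noteq> Q" for P Q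
    proof -
      obtain n n' where n: "n \<in> \<Lambda>" "P = f ` residents n" "n' \<in> \<Lambda>" "Q = f ` residents n'"
        using PQ(1,2) by (auto simp: \<Lambda>'_def)
      then have "residents n \<inter> residents n' = {}"
        using index_setD(6)[OF \<Lambda>] PQ(3) by blast
      then show ?thesis
        using n image_Int[OF inj, of "residents n" "residents n'"] by (simp add: disjnt_def)
    qed
  qed
  moreover have "inj_on residents \<Lambda>'"
  proof (rule inj_onI)
    fix m m'
    assume m: "m \<in> \<Lambda>'" "m' \<in> \<Lambda>'" "residents m = residents m'"
    then obtain n n' where n: "n \<in> \<Lambda>" "m = image_nation f n" "n' \<in> \<Lambda>" "m' = image_nation f n'"
      by (auto simp: \<Lambda>'_def)
    then have "residents n = residents n'"
      using m(3) inj by (simp add: inj_image_eq_iff)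
    then have "n = n'"
      using index_setD(4,6)[OF \<Lambda>] n(1,3) by blast
    then show "m = m'"
      using n by simp
  qed
  moreover have "\<forall>m\<in>\<Lambda>'. top_county m \<inter> bottom_county m = {} \<and> top_county m \<noteq> {} \<and> sign m \<in> {1, - 1}"
    using index_setD(7,8,9)[OF \<Lambda>] by (auto simp: \<Lambda>'_def simp flip: image_Int[OF inj])
  ultimately have \<Lambda>': "\<Lambda>' \<in> index_set N"
    by (simp add: index_set_def)
  have card: "card \<Lambda>' = card \<Lambda>"
    using inj_image_nation[OF inj] by (simp add: \<Lambda>'_def card_image inj_on_subset)
  have "x \<in> param_space \<Lambda>'"
    using x card rank by (auto simp: param_space_def \<Lambda>'_def)
  then show "(\<Lambda>', x) \<in> param_index_set N"
    using \<Lambda>' by (simp add: param_index_set_def)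
  have f_in: "f i \<in> {1..N}" if "i \<in> {1..N}" for i
    using permutes_in_image[OF f] that by simp
  have nation: "nation_of \<Lambda>' (f i) = image_nation f (nation_of \<Lambda> i)" if "i \<in> {1..N}" for i
    by (rule nation_of_eq[OF \<Lambda>']) (use nation_of_in[OF \<Lambda> that] in \<open>auto simp: \<Lambda>'_def\<close>)
  have top: "is_top \<Lambda>' (f i) = is_top \<Lambda> i" if "i \<in> {1..N}" for i
    using inj by (simp add: is_top_def nation[OF that] inj_image_mem_iff)
  have rank': "rank \<Lambda>' (image_nation f (nation_of \<Lambda> i)) = rank \<Lambda> (nation_of \<Lambda> i)" if "i \<in> {1..N}" for i
    using rank nation_of_in(1)[OF \<Lambda> that] by simp
  define S R S' R' where "S = fst (recipe N (\<Lambda>, x))" and "R = snd (recipe N (\<Lambda>, x))"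
    and "S' = fst (recipe N (\<Lambda>', x))" and "R' = snd (recipe N (\<Lambda>', x))"
  have hom: "S \<in> match_hom N 2 2" "R \<in> match_hom N 2 2" "S' \<in> match_hom N 2 2" "R' \<in> match_hom N 2 2"
    by (simp_all add: S_def R_def S'_def R'_def recipe_in_hom)
  have coeffs_relabel: "dg (relabel f M) i j = dg M (f i) (f j)" "off (relabel f M) i j = off M (f i) (f j)" for M i j
    using inj by (auto simp: dg_def off_def relabel_def dest: injD)
  have eq: "dg (relabel f S') i j = dg S i j \<and> off (relabel f S') i j = off S i j \<and>
      dg (relabel f R') i j = dg R i j \<and> off (relabel f R') i j = off R i j"
    if i: "i \<in> {1..N}" and j: "j \<in> {1..N}" for i j
    unfolding coeffs_relabel recipe_coeffs[OF \<Lambda>' f_in[OF i] f_in[OF j], of x, folded S'_def R'_def]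
      recipe_coeffs[OF \<Lambda> i j, of x, folded S_def R_def]
    by (simp only: nation[OF i] nation[OF j] top[OF i] top[OF j] cross_def rank'[OF i] rank'[OF j]
        inj_eq[OF inj_image_nation[OF inj]] image_nation_simps)
  have "relabel f S' = S"
    by (rule match_hom_2_eqI[OF relabel_in_hom[OF f hom(3)] hom(1)]) (use eq in blast)
  moreover have "relabel f R' = R"
    by (rule match_hom_2_eqI[OF relabel_in_hom[OF f hom(4)] hom(2)]) (use eq in blast)
  ultimately have "perm_sym N f (S', R') = (S, R)"
    using hom by (simp add: perm_sym_def match_pairs_def)
  then show "perm_sym N f (recipe N (\<Lambda>', x)) = recipe N (\<Lambda>, x)"
    by (simp add: S_def R_def S'_def R'_def)
qed

section \<open>Consecutive filling and the sorted list of nations\<close>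

fun fill_list :: "nat \<Rightarrow> (int \<times> nat \<times> nat) list \<Rightarrow> nation list" where
  "fill_list k [] = []"
| "fill_list k ((\<epsilon>, p, q) # cs) = Nation {k..<k + p} {k + p..<k + p + q} \<epsilon> # fill_list (k + p + q) cs"

text \<open>The list retains the order of the nations, which the set forgets and the comparison of
  ranks needs.\<close>

lemma set_fill_list: "set (fill_list k cs) = fill k cs"
  by (induction k cs rule: fill_list.induct) simp_all

definition shape :: "nation \<Rightarrow> nat \<times> nat" where
  "shape n = (card (top_county n), card (bottom_county n))"

text \<open>The bijection is glued county by county from bijections onto consecutive intervals. The
  start \<open>k\<close> stays general because it moves along the list.\<close>

lemma fill_list_bij:
  assumes "\<And>n. n \<in> set ns \<Longrightarrow> finite (residents n) \<and> top_county n \<inter> bottom_county n = {}"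
    and "sorted_wrt (\<lambda>n n'. residents n \<inter> residents n' = {}) ns"
  shows "\<exists>f. bij_betw f (\<Union> (residents ` set ns)) {k..<k + (\<Sum>n\<leftarrow>ns. card (residents n))} \<and>
    fill_list k (map (\<lambda>n. (sign n, shape n)) ns) = map (image_nation f) ns"
  using assms
proof (induction ns arbitrary: k)
  case (Cons n ns)
  let ?p = "card (top_county n)" and ?q = "card (bottom_county n)"
  have fin: "finite (top_county n)" "finite (bottom_county n)" and disj: "top_county n \<inter> bottom_county n = {}"
    using Cons.prems(1)[of n] by (auto simp: residents_def)
  have card: "card (residents n) = ?p + ?q"
    using card_Un_disjoint[OF fin disj] by (simp add: residents_def)
  have rest: "residents n \<inter> \<Union> (residents ` set ns) = {}"
    using Cons.prems(2) by auto
  obtain f where f: "bij_betw f (\<Union> (residents ` set ns)) {k + ?p + ?q..<k + ?p + ?q + (\<Sum>n\<leftarrow>ns. card (residents n))}"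
      "fill_list (k + ?p + ?q) (map (\<lambda>n. (sign n, shape n)) ns) = map (image_nation f) ns"
    using Cons.IH[of "k + ?p + ?q"] Cons.prems by auto
  obtain g where g: "bij_betw g (top_county n) {k..<k + ?p}"
    using finite_same_card_bij[OF fin(1), of "{k..<k + ?p}"] by auto
  obtain h where h: "bij_betw h (bottom_county n) {k + ?p..<k + ?p + ?q}"
    using finite_same_card_bij[OF fin(2), of "{k + ?p..<k + ?p + ?q}"] by auto
  define F where "F x = (if x \<in> top_county n then g x else if x \<in> bottom_county n then h x else f x)" for x
  have F: "bij_betw F (top_county n) {k..<k + ?p}" "bij_betw F (bottom_county n) {k + ?p..<k + ?p + ?q}"
    using g h disj by (auto simp: F_def cong: bij_betw_cong) (smt (verit) bij_betw_cong disjoint_iff)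
  have F_rest: "F x = f x" if "x \<in> residents n'" "n' \<in> set ns" for x n'
    using that rest by (auto simp: F_def residents_def)
  have "bij_betw F (\<Union> (residents ` set ns)) {k + ?p + ?q..<k + ?p + ?q + (\<Sum>n\<leftarrow>ns. card (residents n))}"
    using f(1) F_rest by (subst bij_betw_cong[of _ F f]) auto
  moreover have "bij_betw F (residents n) ({k..<k + ?p} \<union> {k + ?p..<k + ?p + ?q})"
    unfolding residents_def by (rule bij_betw_combine[OF F]) auto
  ultimately have "bij_betw F (residents n \<union> \<Union> (residents ` set ns))
      (({k..<k + ?p} \<union> {k + ?p..<k + ?p + ?q}) \<union> {k + ?p + ?q..<k + ?p + ?q + (\<Sum>n\<leftarrow>ns. card (residents n))})"
    by (intro bij_betw_combine) auto
  moreover have "({k..<k + ?p} \<union> {k + ?p..<k + ?p + ?q}) \<union> {k + ?p + ?q..<k + ?p + ?q + (\<Sum>n\<leftarrow>ns. card (residents n))}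
      = {k..<k + (\<Sum>n\<leftarrow>n # ns. card (residents n))}"
    using card by auto
  ultimately have "bij_betw F (\<Union> (residents ` set (n # ns))) {k..<k + (\<Sum>n\<leftarrow>n # ns. card (residents n))}"
    by simp
  moreover have "image_nation F n' = image_nation f n'" if "n' \<in> set ns" for n'
    using F_rest[OF _ that] by (auto simp: image_nation_def residents_def)
  then have "fill_list k (map (\<lambda>n. (sign n, shape n)) (n # ns)) = map (image_nation F) (n # ns)"
    using F f(2) by (simp add: shape_def image_nation_def bij_betw_def)
  ultimately show ?case
    by blast
qed (auto simp: bij_betw_def)

text \<open>Letters are used from \<open>k\<close> upwards, and \<open>p \<ge> 1\<close> keeps the
  set under \<open>Min\<close> nonempty.\<close>

lemma Min_fill_list:
  assumes "\<And>\<epsilon> p q. (\<epsilon>, p, q) \<in> set cs \<Longrightarrow> p \<ge> 1" "n \<in> set (fill_list k cs)"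
  shows "k \<le> Min (residents n)"
  using assms
proof (induction k cs rule: fill_list.induct)
  case (2 k \<epsilon> p q cs)
  then show ?case
    by (fastforce simp: residents_def)
qed simp

text \<open>This is the tie-break of the total order: nations of equal sign and shape stay in list
  order after filling.\<close>

lemma sorted_fill_list:
  assumes "\<And>\<epsilon> p q. (\<epsilon>, p, q) \<in> set cs \<Longrightarrow> p \<ge> 1"
  shows "sorted_wrt (\<lambda>n n'. Min (residents n) < Min (residents n')) (fill_list k cs)"
  using assms
proof (induction k cs rule: fill_list.induct)
  case (2 k \<epsilon> p q cs)
  have p: "p \<ge> 1"
    using 2(2) by auto
  have "Min ({k..<k + p} \<union> {k + p..<k + p + q}) = k"
    using p by (intro Min_eqI) auto
  moreover have "k + p + q \<le> Min (residents n)" if "n \<in> set (fill_list (k + p + q) cs)" for n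
    using Min_fill_list[OF _ that] 2(2) by force
  moreover have "sorted_wrt (\<lambda>n n'. Min (residents n) < Min (residents n')) (fill_list (k + p + q) cs)"
    using 2 by force
  ultimately show ?case
    using p by (fastforce simp: residents_def[of "Nation _ _ _"])
qed simp

text \<open>The predecessors of an entry are exactly the entries before it; ranks count from
  \<open>1\<close> and list positions from \<open>0\<close>.\<close>

lemma rank_nth:
  assumes sorted: "sorted_wrt precedes l" and i: "i < length l"
  shows "rank (set l) (l ! i) = i + 1"
proof -
  have less: "precedes (l ! j) (l ! k)" if "j < k" "k < length l" for j k
    using sorted_wrt_nth_less[OF sorted that] .
  have iff: "precedes (l ! j) (l ! i) \<longleftrightarrow> j < i" if "j < length l" for j
    using less[of j i] less[of i j] that i precedes_irrefl precedes_trans by (metis linorder_neqE_nat)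
  have "distinct l"
    unfolding distinct_conv_nth using less precedes_irrefl by (metis linorder_neqE_nat)
  have "{m \<in> set l. precedes m (l ! i)} = set (take i l)"
  proof (intro subset_antisym subsetI)
    fix m
    assume "m \<in> {m \<in> set l. precedes m (l ! i)}"
    then obtain j where "j < length l" "m = l ! j" "j < i"
      using iff by (auto simp: in_set_conv_nth)
    then show "m \<in> set (take i l)"
      using i by (auto simp: in_set_conv_nth)
  next
    fix m
    assume "m \<in> set (take i l)"
    then obtain j where "j < i" "m = l ! j"
      using i by (auto simp: in_set_conv_nth)
    then show "m \<in> {m \<in> set l. precedes m (l ! i)}"
      using less[of j i] i by auto
  qed
  then show ?thesis
    using \<open>distinct l\<close> i by (simp add: rank_def distinct_card)
qed

lemma sorted_nations:
  assumes "\<Lambda> \<in> index_set N"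
  obtains ns where "set ns = \<Lambda>" "sorted_wrt precedes ns" "distinct ns"
proof -
  obtain xs where xs: "set xs = \<Lambda>" "distinct xs"
    using finite_distinct_list[OF index_setD(1)[OF assms]] by blast
  define ns where "ns = sort_key (rank \<Lambda>) xs"
  have ns: "set ns = \<Lambda>" "distinct ns"
    using xs by (simp_all add: ns_def)
  have "precedes (ns ! i) (ns ! j)" if "i < j" "j < length ns" for i j
  proof -
    have "rank \<Lambda> (ns ! i) \<le> rank \<Lambda> (ns ! j)"
      using sorted_nth_mono[of "map (rank \<Lambda>) ns" i j] that by (simp add: ns_def)
    moreover have "ns ! i \<noteq> ns ! j"
      using ns(2) that by (simp add: nth_eq_iff_index_eq)
    moreover have "ns ! i \<in> \<Lambda>" "ns ! j \<in> \<Lambda>"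
      using ns(1) that by auto
    ultimately show ?thesis
      using precedes_total[OF assms] rank_less[OF index_setD(1)[OF assms]] by (meson leD)
  qed
  then have "sorted_wrt precedes ns"
    by (simp add: sorted_wrt_iff_nth_less)
  then show ?thesis
    using that ns by blast
qed

text \<open>\<open>comp_le\<close> is antisymmetric, since sum and second part determine a
  composition. This justifies the definite description in \<open>ordered_list\<close>.\<close>

lemma sorted_wrt_comp_le_unique:
  assumes "sorted_wrt comp_le xs" "sorted_wrt comp_le ys" "mset xs = mset ys"
  shows "xs = ys"
  using assms
proof (induction xs arbitrary: ys)
  case (Cons x xs)
  then obtain y ys' where ys: "ys = y # ys'"
    by (cases ys) auto
  have "x \<in> set ys" "y \<in> set (x # xs)"
    using Cons.prems(3) ys by (metis list.set_intros(1) set_mset_mset)+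
  then have "x = y \<or> comp_le x y \<and> comp_le y x"
    using Cons.prems(1,2) ys by auto
  then have "x = y"
    by (auto simp: comp_le_def split: prod.splits)
  then show ?case
    using Cons ys by auto
qed simp

lemma ordered_list_eq: "sorted_wrt comp_le xs \<Longrightarrow> ordered_list (mset xs) = xs"
  unfolding ordered_list_def using sorted_wrt_comp_le_unique by (intro the_equality) auto

lemma filter_append_filter:
  "sorted_wrt (\<lambda>x y. P y \<longrightarrow> P x) xs \<Longrightarrow> filter P xs @ filter (\<lambda>x. \<not> P x) xs = xs"
proof (induction xs)
  case (Cons x xs)
  then show ?case
    by (cases "P x") (auto simp: filter_empty_conv filter_id_conv)
qed simp

text \<open>Renumbering along the total order yields a standard index in which every nation keeps
  its position.\<close>

lemma standard_representative:
  assumes p: "(\<Lambda>, x) \<in> param_index_set N"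
  obtains \<Lambda>' f where "(\<Lambda>', x) \<in> standard_param_index_set N" "f permutes {1..N}"
    "perm_sym N f (recipe N (\<Lambda>', x)) = recipe N (\<Lambda>, x)"
proof -
  have \<Lambda>: "\<Lambda> \<in> index_set N"
    using p by (simp add: param_index_set_def)
  obtain ns where ns: "set ns = \<Lambda>" "sorted_wrt precedes ns" "distinct ns"
    by (rule sorted_nations[OF \<Lambda>])
  have fin: "finite (top_county n)" "finite (bottom_county n)" if "n \<in> \<Lambda>" for n
    using index_setD(3)[OF \<Lambda> that] by (simp_all add: residents_def)
  have card_res: "card (residents n) = card (top_county n) + card (bottom_county n)" if "n \<in> \<Lambda>" for n
    using card_Un_disjoint[OF fin[OF that] index_setD(8)[OF \<Lambda> that]] by (simp add: residents_def)
  have top_pos: "card (top_county n) \<ge> 1" if "n \<in> \<Lambda>" for n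
    using fin(1)[OF that] index_setD(9)[OF \<Lambda> that] by (simp add: Suc_le_eq card_gt_0_iff)
  have Union: "\<Union> (residents ` set ns) = {1..N}"
    using index_setD(2,5)[OF \<Lambda>] unfolding ns(1) by blast
  let ?cs = "map (\<lambda>n. (sign n, shape n)) ns"
  have "sorted_wrt (\<lambda>n n'. residents n \<inter> residents n' = {}) ns"
    unfolding sorted_wrt_iff_nth_less
    using index_setD(6)[OF \<Lambda>] ns(1,3) by (metis less_irrefl less_trans nth_eq_iff_index_eq nth_mem)
  then obtain g where g: "bij_betw g {1..N} {1..<1 + (\<Sum>n\<leftarrow>ns. card (residents n))}"
      "fill_list 1 ?cs = map (image_nation g) ns"
    using fill_list_bij[of ns 1] index_setD(3,8)[OF \<Lambda>] ns(1) Union by auto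
  have total: "(\<Sum>n\<leftarrow>ns. card (residents n)) = N"
    using bij_betw_same_card[OF g(1)] by simp
  have interval: "{1..<1 + N} = {1..N}"
    by auto
  \<comment> \<open>Extended by the identity, because \<open>permutes\<close> requires fixed points
    outside the alphabet.\<close>
  define f where "f i = (if i \<in> {1..N} then g i else i)" for i
  have "bij_betw f {1..N} {1..N}"
    using g(1) unfolding total interval by (subst bij_betw_cong[of _ _ g]) (auto simp: f_def)
  then have f: "f permutes {1..N}"
    by (intro bij_imp_permutes) (auto simp: f_def)
  have "image_nation f n = image_nation g n" if "n \<in> \<Lambda>" for n
    using index_setD(2)[OF \<Lambda> that] by (auto simp: image_nation_def residents_def f_def image_iff subset_iff)
  then have fill: "fill_list 1 ?cs = map (image_nation f) ns"
    using g(2) ns(1) by simp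
  define \<Lambda>' where "\<Lambda>' = image_nation f ` \<Lambda>"
  have set_fill: "set (map (image_nation f) ns) = \<Lambda>'"
    by (simp add: \<Lambda>'_def ns(1))
  have "sorted_wrt precedes (map (image_nation f) ns)"
    unfolding sorted_wrt_iff_nth_less
  proof (intro allI impI)
    fix i j
    assume ij: "i < j" "j < length (map (image_nation f) ns)"
    have "precedes (ns ! i) (ns ! j)"
      using sorted_wrt_nth_less[OF ns(2)] ij by simp
    \<comment> \<open>Signs and cardinalities survive an injective relabelling; only the smallest
      residents change, and consecutive filling orders them like the list.\<close>
    moreover have "sorted_wrt (\<lambda>n n'. Min (residents n) < Min (residents n')) (map (image_nation f) ns)"
      unfolding fill[symmetric] using top_pos ns(1) by (intro sorted_fill_list) (auto simp: shape_def)
    then have "Min (residents (map (image_nation f) ns ! i)) < Min (residents (map (image_nation f) ns ! j))"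
      using sorted_wrt_nth_less ij by blast
    ultimately show "precedes (map (image_nation f) ns ! i) (map (image_nation f) ns ! j)"
      using ij permutes_inj[OF f] by (auto simp: precedes_def card_image inj_on_subset)
  qed
  then have rank: "rank \<Lambda>' (image_nation f n) = rank \<Lambda> n" if n: "n \<in> \<Lambda>" for n
  proof -
    obtain i where i: "i < length ns" "n = ns ! i"
      using n ns(1) by (auto simp: in_set_conv_nth)
    then show ?thesis
      using rank_nth[OF \<open>sorted_wrt precedes (map (image_nation f) ns)\<close>, of i] rank_nth[OF ns(2), of i]
      by (simp add: \<Lambda>'_def ns(1))
  qed
  have \<Lambda>': "(\<Lambda>', x) \<in> param_index_set N" "perm_sym N f (recipe N (\<Lambda>', x)) = recipe N (\<Lambda>, x)"
    using recipe_image_nation[OF p f \<Lambda>'_def rank] by blast+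

  \<comment> \<open>The two multisets behind the standard index are the shapes of the positive and
    of the negative nations, already sorted in rank order.\<close>
  let ?pos = "\<lambda>n. sign n = 1"
  let ?A = "map shape (filter ?pos ns)" and ?B = "map shape (filter (\<lambda>n. \<not> ?pos n) ns)"
  have sign: "sign n = 1 \<or> sign n = - 1" if "n \<in> set ns" for n
    using index_setD(7)[OF \<Lambda>] that ns(1) by simp
  \<comment> \<open>The order compares signs before anything else, so splitting by sign and
    concatenating restores the list.\<close>
  have "sorted_wrt (\<lambda>n n'. ?pos n' \<longrightarrow> ?pos n) ns"
    using ns(2) by (rule sorted_wrt_mono_rel[rotated]) (use sign in \<open>force simp: precedes_def\<close>)
  then have split: "filter ?pos ns @ filter (\<lambda>n. \<not> ?pos n) ns = ns"
    by (rule filter_append_filter)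
  have comp_le: "comp_le (shape n) (shape n')"
    if "precedes n n'" "n \<in> set ns" "n' \<in> set ns" "sign n = sign n'" for n n'
    using that card_res ns(1) by (auto simp: precedes_def comp_le_def shape_def)
  have sorted_shapes: "sorted_wrt comp_le (map shape (filter P ns))"
    if "\<And>n n'. n \<in> set ns \<Longrightarrow> n' \<in> set ns \<Longrightarrow> P n \<Longrightarrow> P n' \<Longrightarrow> sign n = sign n'" for P
    unfolding sorted_wrt_map
    by (rule sorted_wrt_mono_rel[OF _ sorted_wrt_filter[OF ns(2)]]) (use comp_le that in auto)
  have "sorted_wrt comp_le ?A"
    by (rule sorted_shapes) simp
  moreover have "sorted_wrt comp_le ?B"
    by (rule sorted_shapes) (use sign in metis)
  ultimately have "standard_index (mset ?A, mset ?B) = fill 1 (map (Pair 1) ?A @ map (Pair (- 1)) ?B)"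
    by (simp add: standard_index_def ordered_list_eq del: mset_map)
  also have "map (Pair 1) ?A @ map (Pair (- 1)) ?B
      = map (\<lambda>n. (sign n, shape n)) (filter ?pos ns @ filter (\<lambda>n. \<not> ?pos n) ns)"
    by (auto dest: sign)
  also have "fill 1 \<dots> = \<Lambda>'"
    unfolding split set_fill_list[symmetric] fill set_fill ..
  finally have standard: "standard_index (mset ?A, mset ?B) = \<Lambda>'" .
  have "mset ?A + mset ?B = mset (map shape (filter ?pos ns @ filter (\<lambda>n. \<not> ?pos n) ns))"
    by simp
  then have sum: "mset ?A + mset ?B = mset (map shape ns)"
    unfolding split .
  have "(\<Sum>(p, q) \<in># mset ?A + mset ?B. p + q) = (\<Sum>n\<leftarrow>ns. case shape n of (p, q) \<Rightarrow> p + q)"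
    unfolding sum by (simp flip: sum_mset_sum_list add: comp_def multiset.map_comp)
  also have "\<dots> = (\<Sum>n\<leftarrow>ns. card (residents n))"
    using card_res ns(1) by (intro arg_cong[where f = sum_list] map_cong) (simp_all add: shape_def)
  finally have "(mset ?A, mset ?B) \<in> signed_multicompositions N"
    using top_pos ns(1) by (auto simp: signed_multicompositions_def total sum shape_def)
  then have "(\<Lambda>', x) \<in> standard_param_index_set N"
    using \<Lambda>'(1) standard unfolding standard_param_index_set_def by blast
  then show ?thesis
    using that f \<Lambda>'(2) by blast
qed


section \<open>The classification theorem\<close>

text \<open>The normalised pair equals a recipe exactly; all freedom sits in the conjugation, which
  is undone by the reciprocal weight.\<close>

lemma functor_imp_recipe:
  assumes "charge_conserving_functor N FO F"
  shows "\<exists>p\<in>param_index_set N. \<exists>h. (\<forall>w. h w \<noteq> 0) \<and> gen_images F = conj_sym N h (recipe N p)"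
proof -
  obtain S R where SR: "gen_images F = (S, R)"
    by (cases "gen_images F")
  then have pair: "loop_pair N S R"
    using functor_imp_loop_pair[OF assms] by simp
  obtain h where h: "\<And>w. h w \<noteq> 0" and normal: "\<And>x y. x \<in> {1..N} \<Longrightarrow> y \<in> {1..N} \<Longrightarrow>
      off (conj_mat h S) x y = 0 \<or> off (conj_mat h S) x y = 1"
    using normalise[OF pair] by blast
  interpret normal_pair N "conj_mat h S" "conj_mat h R"
    by unfold_locales (use loop_pair_conj[OF pair h] normal in auto)
  have "conj_sym N (\<lambda>w. 1 / h w) (recipe N (index, coords)) = (S, R)"
    using hom unfolding recipe_index by (simp add: conj_sym_def match_pairs_def conj_mat_inverse[OF h])
  then show ?thesis
    using h by (intro bexI[OF _ coords_in] exI[of _ "\<lambda>w. 1 / h w"]) (simp add: SR)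
qed

theorem theorem7p3:
  fixes N :: nat
  assumes "N \<ge> 1"
  shows
    "(\<forall>p \<in> param_index_set N. gives_functor N (recipe N p)) \<and>
     (\<forall>FO F. charge_conserving_functor N FO F \<longrightarrow>
        (\<exists>p \<in> param_index_set N. \<exists>g \<in> x_symmetries N. gen_images F = g (recipe N p))) \<and>
     (\<forall>p \<in> standard_param_index_set N. gives_functor N (recipe N p)) \<and>
     (\<forall>FO F. charge_conserving_functor N FO F \<longrightarrow>
        (\<exists>p \<in> standard_param_index_set N. \<exists>g \<in> symmetry_group N. gen_images F = g (recipe N p)))"
proof (intro conjI allI impI ballI)
  show functor_A: "gives_functor N (recipe N p)" if "p \<in> param_index_set N" for p
    using gives_functorI[OF loop_pair_recipe[OF that]] by simp
  show "gives_functor N (recipe N p)" if "p \<in> standard_param_index_set N" for p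
    using functor_A that by (auto simp: standard_param_index_set_def)
next
  fix FO F
  assume "charge_conserving_functor N FO F"
  then obtain p h where "p \<in> param_index_set N" "\<forall>w. h w \<noteq> 0" "gen_images F = conj_sym N h (recipe N p)"
    using functor_imp_recipe by blast
  then show "\<exists>p \<in> param_index_set N. \<exists>g \<in> x_symmetries N. gen_images F = g (recipe N p)"
    using conj_sym_in by blast
next
  fix FO F
  assume "charge_conserving_functor N FO F"
  then obtain p h where p: "p \<in> param_index_set N" and h: "\<forall>w. h w \<noteq> 0"
      and F: "gen_images F = conj_sym N h (recipe N p)"
    using functor_imp_recipe by blast
  obtain \<Lambda> x where p_eq: "p = (\<Lambda>, x)"
    by (cases p)
  obtain \<Lambda>' f where \<Lambda>': "(\<Lambda>', x) \<in> standard_param_index_set N" and f: "f permutes {1..N}"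
      and perm: "perm_sym N f (recipe N (\<Lambda>', x)) = recipe N p"
    using standard_representative[OF p[unfolded p_eq]] unfolding p_eq by blast
  have "recipe N (\<Lambda>', x) \<in> match_pairs N"
    using recipe_in_hom[of N "(\<Lambda>', x)"] by (simp add: match_pairs_def mem_Times_iff)
  \<comment> \<open>The relabelling acts first, then the diagonal conjugation; their composite is a
    single element of the generated group.\<close>
  then have "gen_images F = compose (match_pairs N) (conj_sym N h) (perm_sym N f) (recipe N (\<Lambda>', x))"
    by (simp add: compose_eq perm F)
  then show "\<exists>p \<in> standard_param_index_set N. \<exists>g \<in> symmetry_group N. gen_images F = g (recipe N p)"
    using conj_perm_in_symmetry_group[of h f N] h f \<Lambda>' by blast
qed

end
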